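(* Let $\mathbf{X}$ be an isotropic unimodal Lévy process on $\mathbb{R}^d$ with Lévy–Khintchine exponent $\psi\in\Pi^\infty_\ell$ for some bounded $\ell\in\mathcal{R}^\infty_0$. Then \[ \lim_{t\to0^+,\ t\psi(|x|^{-1})\to\infty}\frac{p(t,x)}{t|x|^{-d}\ell(|x|^{-1})e^{-t\psi(|x|^{-1})}}=\frac{\Gamma(d/2)}{2\pi^{d/2}}. \]
   Context: An isotropic unimodal Lévy process on $\mathbb{R}^d$ is a pure-jump Lévy process $\mathbf{X}=(X_t)_{t\ge0}$, $X_0=0$, with $\mathbb{E}e^{i\langle\xi,X_t\rangle}=e^{-t\psi(\xi)}$, $\psi(\xi)=\int_{\mathbb{R}^d}(1-\cos\langle\xi,x\rangle)\,\nu(\mathrm{d}x)$, where the Lévy measure has a radial, radially non-increasing density $\nu$; for $t>0$ the law of $X_t$ on $\mathbb{R}^d\setminus\{0\}$ has a radial non-increasing density $p(t,x)$. Radial functions are written as functions of $|x|$. $\ell\in\mathcal{R}^\infty_0$ means $\ell$ positive on some $[a,\infty)$ with $\ell(\lambda x)/\ell(x)\to1$ as $x\to\infty$ for all $\lambda>0$; $\Pi^\infty_\ell$ is the set of $f:[a,\infty)\to[0,\infty)$ with $\lim_{x\to\infty}(f(\lambda x)-f(x))/\ell(x)=\log\lambda$ for all $\lambda>0$. The joint limit is along all sequences $t_n\to0^+$, $x_n\neq0$, with $t_n\psi(|x_n|^{-1})\to\infty$. *)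

theory Defs
  imports "HOL-Probability.Probability"
begin

definition radial :: "('a::euclidean_space \<Rightarrow> real) \<Rightarrow> bool" where
  "radial f \<longleftrightarrow> (\<forall>x y. norm x = norm y \<longrightarrow> f x = f y)"

definition radially_nonincreasing :: "('a::euclidean_space \<Rightarrow> real) \<Rightarrow> bool" where
  "radially_nonincreasing f \<longleftrightarrow> (\<forall>x y. 0 < norm x \<and> norm x \<le> norm y \<longrightarrow> f y \<le> f x)"

definition levy_density :: "('a::euclidean_space \<Rightarrow> real) \<Rightarrow> bool" where
  "levy_density \<nu> \<longleftrightarrow> \<nu> \<in> borel_measurable lborel \<and> (\<forall>x. 0 \<le> \<nu> x) \<and>
     (\<integral>\<^sup>+ x. ennreal (min 1 ((norm x)\<^sup>2) * \<nu> x) \<partial>lborel) < \<infinity>"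

definition levy_exponent :: "('a::euclidean_space \<Rightarrow> real) \<Rightarrow> 'a \<Rightarrow> real" where
  "levy_exponent \<nu> \<xi> = (\<integral> x. (1 - cos (\<xi> \<bullet> x)) * \<nu> x \<partial>lborel)"

definition isotropic_unimodal_levy ::
    "'b measure \<Rightarrow> (real \<Rightarrow> 'b \<Rightarrow> 'a::euclidean_space) \<Rightarrow> ('a \<Rightarrow> real) \<Rightarrow> bool" where
  "isotropic_unimodal_levy M X \<nu> \<longleftrightarrow>
     prob_space M \<and> levy_density \<nu> \<and> radial \<nu> \<and> radially_nonincreasing \<nu> \<and>
     (\<forall>\<omega>\<in>space M. X 0 \<omega> = 0) \<and>
     (\<forall>t\<ge>0. X t \<in> borel_measurable M) \<and>
     (\<forall>t\<ge>0. \<forall>\<xi>. (CLINT x | distr M borel (X t). cis (\<xi> \<bullet> x))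
                    = complex_of_real (exp (- (t * levy_exponent \<nu> \<xi>))))"

definition transition_density ::
    "'b measure \<Rightarrow> (real \<Rightarrow> 'b \<Rightarrow> 'a::euclidean_space) \<Rightarrow> (real \<Rightarrow> 'a \<Rightarrow> real) \<Rightarrow> bool" where
  "transition_density M X p \<longleftrightarrow>
     (\<forall>t>0. p t \<in> borel_measurable lborel \<and> (\<forall>x. 0 \<le> p t x) \<and>
        (\<forall>A\<in>sets borel. emeasure (distr M borel (X t)) (A - {0})
            = (\<integral>\<^sup>+ x\<in>A - {0}. ennreal (p t x) \<partial>lborel)))"

definition slowly_varying_infty :: "(real \<Rightarrow> real) \<Rightarrow> bool" where
  "slowly_varying_infty l \<longleftrightarrow> (\<exists>a. \<forall>x\<ge>a. 0 < l x) \<and>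
     (\<forall>c>0. ((\<lambda>x. l (c * x) / l x) \<longlongrightarrow> 1) at_top)"

definition de_haan_class :: "(real \<Rightarrow> real) \<Rightarrow> (real \<Rightarrow> real) \<Rightarrow> bool" where
  "de_haan_class l f \<longleftrightarrow> (\<exists>a. \<forall>x\<ge>a. 0 \<le> f x) \<and>
     (\<forall>c>0. ((\<lambda>x. (f (c * x) - f x) / l x) \<longlongrightarrow> ln c) at_top)"

end

(*
  Gaussian averages turn the characteristic function of X_t into a Laplace transform of |X_t|^2: if
  g is a standard Gaussian vector, then E exp(- s^2 |X_t|^2 / 2) = E exp(- t psi(s |g|)). Since psi
  is in the de Haan class of a bounded l, the increment t (psi(c x) - psi(x)) tends to 0 and is
  asymptotic to t l(x) ln c, so with w = t l(x) exp(- t psi(x)) the differences of these averages at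
  s = c x and s = x, divided by w, tend to - ln c. (Dominated convergence: Potter bounds control the
  quotients by |g|^(1/2) + |g|^(-1/2).)
  Hence for V = x^2 |X_t|^2 / 2 the law of V divided by w / 2 behaves like dv / v: both, weighted by
  exp(- v) (1 - exp(- v)) to make them finite, have asymptotically the same moments in exp(- v), and
  the method of moments gives P(a < V <= b) / (w / 2) --> ln b - ln a.
  Since p(t,.) is radially decreasing, its value at a point is squeezed between its averages over
  thin shells on both sides of that point; letting their width tend to 0 gives 1 / (d vol(B_1)).
*)
theory Submission
  imports Defs
begin

section \<open>Uniform bounds for increments\<close>

lemma measure_eventually_tendsto:
  assumes S: "S \<in> fmeasurable M"
    and sets: "\<And>n. {x \<in> S. P n x} \<in> sets M"
    and ev: "\<And>x. x \<in> S \<Longrightarrow> eventually (\<lambda>n. P n x) sequentially"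
  shows "(\<lambda>n. measure M {x \<in> S. \<forall>m\<ge>n. P m x}) \<longlonglongrightarrow> measure M S"
proof -
  let ?A = "\<lambda>n. {x \<in> S. \<forall>m\<ge>n. P m x}"
  have A: "?A n \<in> fmeasurable M" for n
  proof -
    have "?A n = (\<Inter>m\<in>{n..}. {x \<in> S. P m x})" by auto
    moreover have "(\<Inter>m\<in>{n..}. {x \<in> S. P m x}) \<in> sets M"
      using sets by (intro sets.countable_INT) auto
    ultimately show ?thesis by (intro fmeasurableI2[OF S]) auto
  qed
  have union: "(\<Union>n. ?A n) = S" using ev by (auto simp: eventually_sequentially)
  have "(\<lambda>n. measure M (?A n)) \<longlonglongrightarrow> measure M (\<Union>n. ?A n)"
  proof (rule Lim_measure_incseq)
    show "range ?A \<subseteq> sets M" using A by blast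
    show "incseq ?A" unfolding incseq_def by fastforce
    show "emeasure M (\<Union>n. ?A n) \<noteq> \<infinity>" unfolding union using S by (auto simp: fmeasurable_def)
  qed
  then show ?thesis by (simp only: union)
qed

lemma lmeasurable_meets_translate:
  fixes V W :: "real set"
  assumes V: "V \<in> lmeasurable" "V \<subseteq> {a..b}" and W: "W \<in> lmeasurable" "W \<subseteq> {a..b}"
    and u: "0 \<le> u"
    and large: "measure lebesgue {a..b + u} < measure lebesgue V + measure lebesgue W"
  shows "\<exists>w\<in>W. u + w \<in> V"
proof (rule ccontr)
  assume "\<not> ?thesis"
  then have "V \<inter> (+) u ` W = {}" by auto
  moreover have W': "(+) u ` W \<in> lmeasurable" using W(1) by (rule measurable_translation)
  ultimately have "measure lebesgue (V \<union> (+) u ` W) = measure lebesgue V + measure lebesgue W"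
    using V(1) by (subst measure_Union) (auto simp: measure_translation fmeasurable_def)
  moreover have "measure lebesgue (V \<union> (+) u ` W) \<le> measure lebesgue {a..b + u}"
  proof (rule measure_mono_fmeasurable)
    show "V \<union> (+) u ` W \<subseteq> {a..b + u}" using V(2) W(2) u by force
  qed (use V(1) W' in auto)
  ultimately show False using large by simp
qed

definition small_shifts :: "(real \<Rightarrow> real) \<Rightarrow> real \<Rightarrow> (nat \<Rightarrow> real) \<Rightarrow> nat \<Rightarrow> real set" where
  "small_shifts f K x n = {v \<in> {0..2}. \<forall>m\<ge>n. \<bar>f (x m + v) - f (x m)\<bar> \<le> K}"

lemma small_shifts_subset: "small_shifts f K x n \<subseteq> {0..2}"
  by (auto simp: small_shifts_def)

lemma sets_small_shifts:
  assumes [measurable]: "f \<in> borel_measurable borel"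
  shows "small_shifts f K x n \<in> sets lborel"
  by (auto simp: small_shifts_def)

lemma lmeasurable_small_shifts:
  assumes "f \<in> borel_measurable borel"
  shows "small_shifts f K x n \<in> lmeasurable"
  using sets_small_shifts[OF assms] small_shifts_subset
  by (intro bounded_set_imp_lmeasurable bounded_subset[OF bounded_closed_interval]
      sets_completionI_sets)

lemma measure_small_shifts_tendsto:
  assumes f [measurable]: "f \<in> borel_measurable borel"
    and bound: "\<And>v. v \<in> {0..2} \<Longrightarrow> eventually (\<lambda>x. \<bar>f (x + v) - f x\<bar> \<le> K) at_top"
    and x: "filterlim x at_top sequentially"
  shows "(\<lambda>n. measure lebesgue (small_shifts f K x n)) \<longlonglongrightarrow> 2"
proof -
  have "(\<lambda>n. measure lborel (small_shifts f K x n)) \<longlonglongrightarrow> measure lborel {0..2::real}"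
    unfolding small_shifts_def
  proof (rule measure_eventually_tendsto)
    show "{v \<in> {0..2}. \<bar>f (x n + v) - f (x n)\<bar> \<le> K} \<in> sets lborel" for n by auto
    show "eventually (\<lambda>n. \<bar>f (x n + v) - f (x n)\<bar> \<le> K) sequentially" if "v \<in> {0..2}" for v
      using eventually_compose_filterlim[OF bound[OF that] x] .
  qed (simp add: fmeasurable_def)
  then show ?thesis by (simp add: measure_completion[OF sets_small_shifts[OF f]])
qed

text \<open>If the bound failed along \<open>x n\<close>, \<open>u n\<close>, the small shifts for \<open>x n\<close> and those for \<open>x n + u n\<close>
  would both fill most of \<open>{0..2}\<close>, hence meet after translation by \<open>u n\<close>.\<close>

lemma uniformly_bounded_increments:
  fixes f :: "real \<Rightarrow> real"
  assumes f: "f \<in> borel_measurable borel"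
    and bound: "\<And>v. v \<in> {0..2} \<Longrightarrow> eventually (\<lambda>x. \<bar>f (x + v) - f x\<bar> \<le> K) at_top"
  shows "\<exists>x0. \<forall>x\<ge>x0. \<forall>u\<in>{0..1}. \<bar>f (x + u) - f x\<bar> \<le> 2 * K"
proof (rule ccontr)
  assume "\<not> ?thesis"
  then have "\<forall>n::nat. \<exists>x u. real n \<le> x \<and> u \<in> {0..1} \<and> 2 * K < \<bar>f (x + u) - f x\<bar>"
    by (meson not_le)
  then obtain x u where x: "\<And>n::nat. real n \<le> x n" and u: "\<And>n. u n \<in> {0..1::real}"
    and large: "\<And>n. 2 * K < \<bar>f (x n + u n) - f (x n)\<bar>"
    by metis
  have mostly_small: "eventually (\<lambda>n. 3/2 < measure lebesgue (small_shifts f K y n)) sequentially"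
    if "\<And>n. real n \<le> y n" for y
  proof (rule order_tendstoD[OF measure_small_shifts_tendsto[OF f bound]])
    show "filterlim y at_top sequentially"
      using that by (intro filterlim_at_top_mono[OF filterlim_real_sequentially]) auto
  qed simp_all
  define y where "y n = x n + u n" for n
  have "real n \<le> y n" for n using x[of n] u[of n] by (simp add: y_def)
  from eventually_conj[OF mostly_small[OF x] mostly_small[OF this]]
  obtain n where "3/2 < measure lebesgue (small_shifts f K x n)"
      "3/2 < measure lebesgue (small_shifts f K y n)"
    using eventually_happens'[OF sequentially_bot] by blast
  then obtain v where "v \<in> small_shifts f K y n" "u n + v \<in> small_shifts f K x n"
    using lmeasurable_meets_translate[where V="small_shifts f K x n" and W="small_shifts f K y n",
        OF lmeasurable_small_shifts[OF f] small_shifts_subset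
          lmeasurable_small_shifts[OF f] small_shifts_subset, of "u n"] u[of n]
    by auto
  then have "\<bar>f (y n + v) - f (y n)\<bar> \<le> K" "\<bar>f (x n + (u n + v)) - f (x n)\<bar> \<le> K"
    by (auto simp: small_shifts_def)
  then show False using large[of n] by (simp add: y_def add.assoc)
qed

lemma linearly_bounded_increments:
  fixes f :: "real \<Rightarrow> real"
  assumes f: "f \<in> borel_measurable borel"
    and bound: "\<And>v. v \<in> {0..2} \<Longrightarrow> eventually (\<lambda>x. \<bar>f (x + v) - f x\<bar> \<le> K) at_top"
  shows "\<exists>x0. \<forall>x\<ge>x0. \<forall>y\<ge>x0. \<bar>f y - f x\<bar> \<le> 2 * K * (1 + \<bar>y - x\<bar>)"
proof -
  obtain x0 where x0: "\<And>x u. x0 \<le> x \<Longrightarrow> u \<in> {0..1} \<Longrightarrow> \<bar>f (x + u) - f x\<bar> \<le> 2 * K"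
    using uniformly_bounded_increments[OF f bound] by blast
  have K: "0 \<le> K" using x0[of x0 0] by simp
  have unit_steps: "\<bar>f (x + real n + u) - f x\<bar> \<le> 2 * K * (1 + real n)"
    if "x0 \<le> x" "u \<in> {0..1}" for x u and n :: nat
    using that(1)
  proof (induction n arbitrary: x)
    case 0 then show ?case using x0[of x u] that by simp
  next
    case (Suc n)
    have "\<bar>f (x + 1 + real n + u) - f (x + 1)\<bar> \<le> 2 * K * (1 + real n)" using Suc by simp
    moreover have "\<bar>f (x + 1) - f x\<bar> \<le> 2 * K" using x0[of x 1] Suc by simp
    ultimately show ?case by (simp add: algebra_simps)
  qed
  have forward: "\<bar>f y - f x\<bar> \<le> 2 * K * (1 + \<bar>y - x\<bar>)" if "x0 \<le> x" "x \<le> y" for x y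
  proof -
    define n where "n = nat \<lfloor>y - x\<rfloor>"
    have n: "real n \<le> y - x" "y - x - real n \<in> {0..1}"
      using that by (auto simp: n_def) linarith+
    have "\<bar>f (x + real n + (y - x - real n)) - f x\<bar> \<le> 2 * K * (1 + real n)"
      using that n by (intro unit_steps) auto
    also have "\<dots> \<le> 2 * K * (1 + \<bar>y - x\<bar>)" using K n that by (intro mult_left_mono) auto
    finally show ?thesis by simp
  qed
  show ?thesis
  proof (intro exI[of _ x0] allI impI)
    fix x y assume "x0 \<le> x" "x0 \<le> y"
    then show "\<bar>f y - f x\<bar> \<le> 2 * K * (1 + \<bar>y - x\<bar>)"
      using forward[of x y] forward[of y x] by (cases "x \<le> y") (auto simp: abs_minus_commute)
  qed
qed

lemma logarithmically_bounded_increments: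
  fixes f :: "real \<Rightarrow> real"
  assumes f: "(\<lambda>v. f (exp v)) \<in> borel_measurable borel"
    and bound: "\<And>c. 1 \<le> c \<Longrightarrow> c \<le> exp 2 \<Longrightarrow> eventually (\<lambda>x. \<bar>f (c * x) - f x\<bar> \<le> K) at_top"
  shows "\<exists>x0>0. \<forall>x\<ge>x0. \<forall>y\<ge>x0. \<bar>f y - f x\<bar> \<le> 2 * K * (1 + \<bar>ln y - ln x\<bar>)"
proof -
  have "eventually (\<lambda>x. \<bar>f (exp (x + v)) - f (exp x)\<bar> \<le> K) at_top" if "v \<in> {0..2}" for v
    using eventually_compose_filterlim[OF bound[of "exp v"] exp_at_top] that
    by (simp add: exp_add mult.commute)
  from linearly_bounded_increments[OF f this] obtain x0 where
    x0: "\<And>x y. x0 \<le> x \<Longrightarrow> x0 \<le> y \<Longrightarrow> \<bar>f (exp y) - f (exp x)\<bar> \<le> 2 * K * (1 + \<bar>y - x\<bar>)"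
    by blast
  show ?thesis
  proof (intro exI[of _ "exp x0"] conjI allI impI)
    fix x y assume "exp x0 \<le> x" "exp x0 \<le> y"
    moreover from this have "0 < x" "0 < y" by (auto intro: less_le_trans[OF exp_gt_zero])
    ultimately show "\<bar>f y - f x\<bar> \<le> 2 * K * (1 + \<bar>ln y - ln x\<bar>)"
      using x0[of "ln x" "ln y"] by (simp add: ln_ge_iff)
  qed simp
qed

section \<open>Asymptotic bounds in the de Haan class\<close>

lemma ln_diff_tendsto_0:
  fixes f g :: "'i \<Rightarrow> real"
  assumes ratio: "((\<lambda>x. f x / g x) \<longlongrightarrow> 1) F" and pos: "eventually (\<lambda>x. 0 < g x) F"
  shows "((\<lambda>x. ln (f x) - ln (g x)) \<longlongrightarrow> 0) F"
proof (rule Lim_transform_eventually)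
  show "((\<lambda>x. ln (f x / g x)) \<longlongrightarrow> 0) F" using tendsto_ln[OF ratio] by simp
  show "eventually (\<lambda>x. ln (f x / g x) = ln (f x) - ln (g x)) F"
    using order_tendstoD(1)[OF ratio zero_less_one] pos
    by eventually_elim (auto simp: zero_less_divide_iff ln_div)
qed

lemma filterlim_const_mult_at_top:
  fixes c :: real
  assumes "0 < c"
  shows "filterlim (\<lambda>x. c * x) at_top at_top"
  using filterlim_tendsto_pos_mult_at_top[OF tendsto_const assms filterlim_ident] .

locale de_haan_exponent =
  fixes \<psi> l :: "real \<Rightarrow> real"
  assumes nonneg: "0 \<le> s \<Longrightarrow> 0 \<le> \<psi> s"
    and borel_measurable_abs: "(\<lambda>s. \<psi> \<bar>s\<bar>) \<in> borel_measurable borel"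
    and locally_bounded: "\<exists>C. \<forall>s\<in>{0..b}. \<psi> s \<le> C"
    and slowly_varying: "slowly_varying_infty l"
    and eventually_bounded: "\<exists>B a. \<forall>x\<ge>a. \<bar>l x\<bar> \<le> B"
    and de_haan: "de_haan_class l \<psi>"
begin

lemma borel_measurable_scaled_exp: "(\<lambda>v. \<psi> (exp v * s)) \<in> borel_measurable borel" if "0 \<le> s"
  using measurable_compose[of "\<lambda>v. exp v * s" borel borel, OF _ borel_measurable_abs] that
  by (simp add: abs_mult)

lemma eventually_l_pos: "eventually (\<lambda>x. 0 < l x) at_top"
  using slowly_varying by (auto simp: slowly_varying_infty_def eventually_at_top_linorder)

lemma eventually_l_le: obtains B where "0 \<le> B" "eventually (\<lambda>x. l x \<le> B) at_top"
proof -
  obtain B a where "\<And>x. a \<le> x \<Longrightarrow> \<bar>l x\<bar> \<le> B" using eventually_bounded by blast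
  then have "l x \<le> max 0 B" if "a \<le> x" for x using that by fastforce
  then show thesis using that[of "max 0 B"] by (auto simp: eventually_at_top_linorder)
qed

lemma increment_tendsto: "0 < c \<Longrightarrow> ((\<lambda>x. (\<psi> (c * x) - \<psi> x) / l x) \<longlongrightarrow> ln c) at_top"
  using de_haan by (simp add: de_haan_class_def)

lemma eventually_increment_le:
  assumes "0 < c"
  shows "eventually (\<lambda>x. \<bar>\<psi> (c * x) - \<psi> x\<bar> \<le> (\<bar>ln c\<bar> + 1) * l x) at_top"
proof -
  have "eventually (\<lambda>x. \<bar>(\<psi> (c * x) - \<psi> x) / l x\<bar> < \<bar>ln c\<bar> + 1) at_top"
    using tendsto_rabs[OF increment_tendsto[OF assms]] by (rule order_tendstoD) simp
  then show ?thesis using eventually_l_pos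
    by eventually_elim (simp add: abs_divide divide_less_eq)
qed

lemma logarithmic_growth:
  obtains K x0 where "0 \<le> K" "0 < x0"
    "\<And>x y. x0 \<le> x \<Longrightarrow> x0 \<le> y \<Longrightarrow> \<bar>\<psi> y - \<psi> x\<bar> \<le> K * (1 + \<bar>ln y - ln x\<bar>)"
proof -
  obtain B where B: "0 \<le> B" "eventually (\<lambda>x. l x \<le> B) at_top" by (rule eventually_l_le)
  have "\<exists>x0>0. \<forall>x\<ge>x0. \<forall>y\<ge>x0. \<bar>\<psi> y - \<psi> x\<bar> \<le> 2 * (3 * B) * (1 + \<bar>ln y - ln x\<bar>)"
  proof (rule logarithmically_bounded_increments)
    show "(\<lambda>v. \<psi> (exp v)) \<in> borel_measurable borel"
      using borel_measurable_scaled_exp[of 1] by simp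
    fix c :: real assume "1 \<le> c" "c \<le> exp 2"
    then have "0 < c" and "\<bar>ln c\<bar> \<le> 2" using ln_le_cancel_iff[of c "exp 2"] by auto
    have l_le: "(\<bar>ln c\<bar> + 1) * l x \<le> 3 * B" if "0 < l x" "l x \<le> B" for x
      using that \<open>\<bar>ln c\<bar> \<le> 2\<close> by (intro mult_mono) auto
    show "eventually (\<lambda>x. \<bar>\<psi> (c * x) - \<psi> x\<bar> \<le> 3 * B) at_top"
      using eventually_increment_le[OF \<open>0 < c\<close>] B(2) eventually_l_pos
      by eventually_elim (use l_le in fastforce)
  qed
  then show thesis using that[of "2 * (3 * B)"] B(1) by auto
qed

text \<open>\<open>l\<close> need not be measurable, so uniform bounds are proved for these increments, which are
  asymptotic to it.\<close>

definition unit_increment :: "real \<Rightarrow> real" where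
  "unit_increment x = \<psi> (exp 1 * x) - \<psi> x"

lemma ln_unit_increment_diff_tendsto: "((\<lambda>x. ln (unit_increment x) - ln (l x)) \<longlongrightarrow> 0) at_top"
  using increment_tendsto[of "exp 1"] eventually_l_pos unfolding unit_increment_def
  by (intro ln_diff_tendsto_0) auto

lemma ln_unit_increment_slowly_varying:
  assumes c: "0 < c"
  shows "((\<lambda>x. ln (unit_increment (c * x)) - ln (unit_increment x)) \<longlongrightarrow> 0) at_top"
proof -
  have "((\<lambda>x. ln (l (c * x)) - ln (l x)) \<longlongrightarrow> 0) at_top"
    using slowly_varying c eventually_l_pos
    by (intro ln_diff_tendsto_0) (auto simp: slowly_varying_infty_def)
  moreover have "((\<lambda>x. ln (unit_increment (c * x)) - ln (l (c * x))) \<longlongrightarrow> 0) at_top"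
    by (rule filterlim_compose[OF ln_unit_increment_diff_tendsto filterlim_const_mult_at_top[OF c]])
  ultimately have "((\<lambda>x. (ln (unit_increment (c * x)) - ln (l (c * x)))
      + (ln (l (c * x)) - ln (l x)) - (ln (unit_increment x) - ln (l x))) \<longlongrightarrow> 0 + 0 - 0) at_top"
    using ln_unit_increment_diff_tendsto by (intro tendsto_add tendsto_diff)
  then show ?thesis by simp
qed

lemma potter_bound:
  assumes \<epsilon>: "0 < \<epsilon>"
  obtains x0 where "0 < x0"
    "\<And>x y. x0 \<le> x \<Longrightarrow> x0 \<le> y \<Longrightarrow> \<bar>ln (l y) - ln (l x)\<bar> \<le> \<epsilon> * (1 + \<bar>ln y - ln x\<bar>)"
proof -
  let ?m = unit_increment
  have close: "eventually (\<lambda>x. \<bar>f x\<bar> \<le> \<epsilon> / 4) at_top" if "(f \<longlongrightarrow> 0) at_top" for f :: "real \<Rightarrow> real"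
    using order_tendstoD(2)[OF tendsto_rabs_zero[OF that], of "\<epsilon> / 4"] \<epsilon>
    by (auto elim: eventually_mono)
  have "\<exists>x0>0. \<forall>x\<ge>x0. \<forall>y\<ge>x0. \<bar>ln (?m y) - ln (?m x)\<bar> \<le> 2 * (\<epsilon> / 4) * (1 + \<bar>ln y - ln x\<bar>)"
  proof (rule logarithmically_bounded_increments)
    show "(\<lambda>v. ln (?m (exp v))) \<in> borel_measurable borel"
      using borel_measurable_scaled_exp[of "exp 1"] borel_measurable_scaled_exp[of 1]
      unfolding unit_increment_def by (auto simp: mult.commute)
    show "eventually (\<lambda>x. \<bar>ln (?m (c * x)) - ln (?m x)\<bar> \<le> \<epsilon> / 4) at_top" if "1 \<le> c" for c
      using that by (intro close ln_unit_increment_slowly_varying) simp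
  qed
  then obtain x1 where x1: "0 < x1" "\<And>x y. x1 \<le> x \<Longrightarrow> x1 \<le> y \<Longrightarrow>
      \<bar>ln (?m y) - ln (?m x)\<bar> \<le> \<epsilon> / 2 * (1 + \<bar>ln y - ln x\<bar>)" by auto
  obtain x2 where x2: "\<And>x. x2 \<le> x \<Longrightarrow> \<bar>ln (?m x) - ln (l x)\<bar> \<le> \<epsilon> / 4"
    using close[OF ln_unit_increment_diff_tendsto] by (auto simp: eventually_at_top_linorder)
  show thesis
  proof (rule that[of "max x1 x2"])
    fix x y assume "max x1 x2 \<le> x" "max x1 x2 \<le> y"
    then have "\<bar>ln (?m y) - ln (?m x)\<bar> \<le> \<epsilon> / 2 * (1 + \<bar>ln y - ln x\<bar>)"
        "\<bar>ln (?m x) - ln (l x)\<bar> \<le> \<epsilon> / 4" "\<bar>ln (?m y) - ln (l y)\<bar> \<le> \<epsilon> / 4"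
      using x1(2) x2 by auto
    then have "\<bar>ln (l y) - ln (l x)\<bar> \<le> \<epsilon> / 2 * (1 + \<bar>ln y - ln x\<bar>) + \<epsilon> / 2" by linarith
    also have "\<dots> \<le> \<epsilon> * (1 + \<bar>ln y - ln x\<bar>)" using \<epsilon> by (simp add: algebra_simps)
    finally show "\<bar>ln (l y) - ln (l x)\<bar> \<le> \<epsilon> * (1 + \<bar>ln y - ln x\<bar>)" .
  qed (use x1(1) in auto)
qed

lemma eventually_le_ln: obtains C where "0 < C" "eventually (\<lambda>x. \<psi> x \<le> C * ln x) at_top"
proof -
  obtain K x0 where K: "0 \<le> K" "0 < x0"
    "\<And>x y. x0 \<le> x \<Longrightarrow> x0 \<le> y \<Longrightarrow> \<bar>\<psi> y - \<psi> x\<bar> \<le> K * (1 + \<bar>ln y - ln x\<bar>)"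
    by (rule logarithmic_growth) blast
  have "eventually (\<lambda>x. \<psi> x0 + K - K * ln x0 \<le> ln x) at_top"
    using ln_at_top by (auto simp: filterlim_at_top)
  then have "eventually (\<lambda>x. \<psi> x \<le> (K + 1) * ln x) at_top"
    using eventually_ge_at_top[of x0]
  proof eventually_elim
    case (elim x)
    then have "\<psi> x - \<psi> x0 \<le> K * (1 + (ln x - ln x0))"
      using K(3)[of x0 x] K(2) by (simp add: abs_of_nonneg)
    then show ?case using elim(1) by (simp add: algebra_simps)
  qed
  then show thesis using that[of "K + 1"] K(1) by simp
qed

lemma eventually_le_powr:
  assumes a: "0 < a"
  shows "eventually (\<lambda>x. \<psi> x \<le> x powr a) at_top"
proof -
  obtain C where C: "0 < C" "eventually (\<lambda>x. \<psi> x \<le> C * ln x) at_top" by (rule eventually_le_ln)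
  have "eventually (\<lambda>x. 4 * C / a\<^sup>2 \<le> ln x) at_top"
    using ln_at_top by (auto simp: filterlim_at_top)
  then show ?thesis using C(2) eventually_gt_at_top[of 1]
  proof eventually_elim
    case (elim x)
    have "C * ln x \<le> (a / 2 * ln x)\<^sup>2"
      using elim(1,3) a by (simp add: field_simps power2_eq_square)
    also have "\<dots> \<le> (exp (a / 2 * ln x))\<^sup>2"
    proof (rule power_mono)
      show "a / 2 * ln x \<le> exp (a / 2 * ln x)"
        using exp_ge_add_one_self[of "a / 2 * ln x"] by linarith
    qed (use elim(3) a in auto)
    also have "\<dots> = x powr a" using elim(3) by (simp add: powr_def flip: exp_double)
    finally show ?case using elim(2) by simp
  qed
qed

lemma eventually_l_ge_powr:
  assumes a: "0 < a"
  shows "eventually (\<lambda>x. x powr (- a) \<le> l x) at_top"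
proof -
  obtain x0 where x0: "0 < x0"
    "\<And>x y. x0 \<le> x \<Longrightarrow> x0 \<le> y \<Longrightarrow> \<bar>ln (l y) - ln (l x)\<bar> \<le> a / 2 * (1 + \<bar>ln y - ln x\<bar>)"
    using potter_bound[of "a / 2"] a by auto
  have "eventually (\<lambda>x. 1 - ln x0 - 2 / a * ln (l x0) \<le> ln x) at_top"
    using ln_at_top by (auto simp: filterlim_at_top)
  then show ?thesis using eventually_ge_at_top[of x0] eventually_l_pos
  proof eventually_elim
    case (elim x)
    have "\<bar>ln x - ln x0\<bar> = ln x - ln x0" using elim(2) x0(1) by simp
    then have "\<bar>ln (l x) - ln (l x0)\<bar> \<le> a / 2 * (1 + (ln x - ln x0))"
      using x0(2)[of x0 x] elim(2) by simp
    then have "ln (l x0) - ln (l x) \<le> a / 2 * (1 + (ln x - ln x0))" by linarith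
    moreover have "a / 2 * (1 - ln x0 - 2 / a * ln (l x0)) \<le> a / 2 * ln x"
      using elim(1) a by (intro mult_left_mono) auto
    moreover have "a / 2 * (1 - ln x0 - 2 / a * ln (l x0)) = a / 2 * (1 - ln x0) - ln (l x0)"
      using a by (simp add: field_simps)
    ultimately have "- a * ln x \<le> ln (l x)" by (simp add: algebra_simps)
    then have "exp (- a * ln x) \<le> exp (ln (l x))" by simp
    then show ?case using elim x0(1) by (simp add: powr_def)
  qed
qed

end

section \<open>Increments along the scales\<close>

lemma exp_minus_one_quotient_tendsto:
  fixes a \<tau> :: "'i \<Rightarrow> real"
  assumes quotient: "((\<lambda>n. a n / \<tau> n) \<longlongrightarrow> A) F" and \<tau>: "(\<tau> \<longlongrightarrow> 0) F"
    and pos: "eventually (\<lambda>n. 0 < \<tau> n) F"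
  shows "((\<lambda>n. (exp (a n) - 1) / \<tau> n) \<longlongrightarrow> A) F"
proof -
  have "((\<lambda>n. a n / \<tau> n * \<tau> n) \<longlongrightarrow> A * 0) F" by (intro tendsto_mult quotient \<tau>)
  then have "((\<lambda>n. a n / \<tau> n * \<tau> n) \<longlongrightarrow> 0) F" by simp
  then have "(a \<longlongrightarrow> 0) F"
    by (rule Lim_transform_eventually) (use pos in \<open>auto elim: eventually_mono\<close>)
  then have "((\<lambda>n. a n / \<tau> n * exp (a n)) \<longlongrightarrow> A * exp 0) F"
    by (intro tendsto_mult quotient tendsto_exp)
  then have upper: "((\<lambda>n. a n / \<tau> n * exp (a n)) \<longlongrightarrow> A) F" by simp
  show ?thesis
  proof (rule tendsto_sandwich[OF _ _ quotient upper])
    show "eventually (\<lambda>n. a n / \<tau> n \<le> (exp (a n) - 1) / \<tau> n) F"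
      using pos
    proof eventually_elim
      case (elim n)
      have "a n \<le> exp (a n) - 1" using exp_ge_add_one_self[of "a n"] by linarith
      with elim show ?case by (intro divide_right_mono) auto
    qed
    show "eventually (\<lambda>n. (exp (a n) - 1) / \<tau> n \<le> a n / \<tau> n * exp (a n)) F"
      using pos
    proof eventually_elim
      case (elim n)
      have "(1 - a n) * exp (a n) \<le> exp (- a n) * exp (a n)"
        using exp_ge_add_one_self[of "- a n"] by (intro mult_right_mono) auto
      then have "exp (a n) - 1 \<le> a n * exp (a n)" by (simp add: algebra_simps flip: exp_add)
      with elim show ?case by (simp add: divide_right_mono)
    qed
  qed
qed

lemma abs_exp_diff_le:
  fixes a b :: real
  assumes "a \<le> M" "b \<le> M"
  shows "\<bar>exp a - exp b\<bar> \<le> \<bar>a - b\<bar> * exp M"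
proof -
  have "exp y - exp x \<le> (y - x) * exp M" if "x \<le> y" "y \<le> M" for x y
  proof -
    have "exp y * (1 + (x - y)) \<le> exp y * exp (x - y)"
      by (intro mult_left_mono exp_ge_add_one_self) auto
    then have "exp y - exp x \<le> (y - x) * exp y" by (simp add: algebra_simps flip: exp_add)
    also have "\<dots> \<le> (y - x) * exp M" using that by (intro mult_left_mono) auto
    finally show ?thesis .
  qed
  from this[of a b] this[of b a] show ?thesis
    using assms by (cases "a \<le> b") (auto simp: abs_real_def)
qed

lemma exp_mult_abs_ln_le:
  fixes a k :: real
  assumes "0 < k"
  shows "exp (a * \<bar>ln k\<bar>) \<le> k powr a + k powr (- a)"
proof (cases "0 \<le> ln k")
  case True
  show ?thesis unfolding abs_of_nonneg[OF True] using assms by (simp add: powr_def)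
next
  case False
  then have nonpos: "ln k \<le> 0" by simp
  show ?thesis unfolding abs_of_nonpos[OF nonpos] using assms by (simp add: powr_def)
qed

locale de_haan_scales = de_haan_exponent +
  fixes t u :: "nat \<Rightarrow> real"
  assumes t_pos: "0 < t n" and t_tendsto: "t \<longlonglongrightarrow> 0" and u_pos: "0 < u n"
    and exponent_at_top: "filterlim (\<lambda>n. t n * \<psi> (u n)) at_top sequentially"
begin

lemma eventually_t_mult_le: "eventually (\<lambda>n. t n * C \<le> \<epsilon>) sequentially" if "0 < \<epsilon>"
proof -
  have "(\<lambda>n. t n * C) \<longlonglongrightarrow> 0" using tendsto_mult_right[OF t_tendsto, of C] by simp
  then have "eventually (\<lambda>n. t n * C < \<epsilon>) sequentially" by (rule order_tendstoD) (rule that)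
  then show ?thesis by (rule eventually_mono) simp
qed

lemma eventually_exponent_ge: "eventually (\<lambda>n. r \<le> t n * \<psi> (u n)) sequentially"
  using exponent_at_top by (auto simp: filterlim_at_top)

lemma u_at_top: "filterlim u at_top sequentially"
  unfolding filterlim_at_top
proof
  fix z
  obtain C where C: "\<And>s. s \<in> {0..z} \<Longrightarrow> \<psi> s \<le> C" using locally_bounded by blast
  show "eventually (\<lambda>n. z \<le> u n) sequentially"
    using eventually_t_mult_le[OF zero_less_one, of C] eventually_exponent_ge[of 2]
  proof eventually_elim
    case (elim n)
    show ?case
    proof (rule ccontr)
      assume "\<not> z \<le> u n"
      then have "t n * \<psi> (u n) \<le> t n * C"
        using C u_pos[of n] t_pos[of n] by (intro mult_left_mono) auto
      then show False using elim by linarith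
    qed
  qed
qed

lemma eventually_at_scale: "eventually P at_top \<Longrightarrow> eventually (\<lambda>n. P (u n)) sequentially"
  by (rule eventually_compose_filterlim[OF _ u_at_top])

definition weight :: "nat \<Rightarrow> real" where
  "weight n = t n * l (u n) * exp (- (t n * \<psi> (u n)))"

lemma eventually_weight_pos: "eventually (\<lambda>n. 0 < weight n) sequentially"
  using eventually_at_scale[OF eventually_l_pos] by eventually_elim (simp add: weight_def t_pos)

lemma eventually_weight_ge_powr:
  assumes a: "0 < a"
  shows "eventually (\<lambda>n. u n powr (- a) \<le> weight n) sequentially"
proof -
  obtain C where C: "0 < C" "eventually (\<lambda>x. \<psi> x \<le> C * ln x) at_top" by (rule eventually_le_ln)
  have b: "0 < a / 3" using a by simp
  show ?thesis
    using eventually_exponent_ge[of 1] eventually_t_mult_le[OF b, of C] eventually_at_scale[OF C(2)]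
      eventually_at_scale[OF eventually_le_powr[OF b]]
      eventually_at_scale[OF eventually_l_ge_powr[OF b]]
      eventually_at_scale[OF eventually_ge_at_top[of 1]]
  proof eventually_elim
    case (elim n)
    have "1 \<le> t n * u n powr (a / 3)"
      using elim(1) mult_left_mono[OF elim(4) less_imp_le[OF t_pos[of n]]] by linarith
    then have t_ge: "u n powr (- (a / 3)) \<le> t n"
      using u_pos[of n] by (simp add: powr_minus field_simps)
    have "t n * \<psi> (u n) \<le> t n * C * ln (u n)"
      using mult_left_mono[OF elim(3) less_imp_le[OF t_pos[of n]]] by simp
    also have "\<dots> \<le> a / 3 * ln (u n)" using elim(2,6) by (intro mult_right_mono) auto
    finally have exp_ge: "u n powr (- (a / 3)) \<le> exp (- (t n * \<psi> (u n)))"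
      using u_pos[of n] by (simp add: powr_def)
    have "u n powr (- a) = u n powr (- (a / 3)) * u n powr (- (a / 3)) * u n powr (- (a / 3))"
      by (simp flip: powr_add)
    also have "\<dots> \<le> t n * l (u n) * exp (- (t n * \<psi> (u n)))"
      using t_ge elim(5) exp_ge
      by (intro mult_mono mult_nonneg_nonneg order_trans[OF powr_ge_zero]) auto
    finally show ?case by (simp add: weight_def)
  qed
qed

definition increment_ratio :: "real \<Rightarrow> real \<Rightarrow> nat \<Rightarrow> real" where
  "increment_ratio c k n =
    (exp (- (t n * \<psi> (c * u n * k))) - exp (- (t n * \<psi> (u n * k)))) / weight n"

lemma increment_ratio_1_tendsto:
  assumes c: "0 < c"
  shows "increment_ratio c 1 \<longlonglongrightarrow> - ln c"
proof -
  have "(\<lambda>n. (exp (- (t n * (\<psi> (c * u n) - \<psi> (u n)))) - 1) / (t n * l (u n))) \<longlonglongrightarrow> - ln c"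
  proof (rule exp_minus_one_quotient_tendsto)
    have "(\<lambda>n. - ((\<psi> (c * u n) - \<psi> (u n)) / l (u n))) \<longlonglongrightarrow> - ln c"
      by (intro tendsto_minus filterlim_compose[OF increment_tendsto[OF c] u_at_top])
    moreover have "- ((\<psi> (c * u n) - \<psi> (u n)) / l (u n))
        = - (t n * (\<psi> (c * u n) - \<psi> (u n))) / (t n * l (u n))" for n
      using t_pos[of n] by simp
    ultimately show "(\<lambda>n. - (t n * (\<psi> (c * u n) - \<psi> (u n))) / (t n * l (u n))) \<longlonglongrightarrow> - ln c"
      by simp
    obtain B where B: "0 \<le> B" "eventually (\<lambda>x. l x \<le> B) at_top" by (rule eventually_l_le)
    show "(\<lambda>n. t n * l (u n)) \<longlonglongrightarrow> 0"
    proof (rule Lim_null_comparison)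
      show "eventually (\<lambda>n. norm (t n * l (u n)) \<le> t n * B) sequentially"
        using eventually_at_scale[OF B(2)] eventually_at_scale[OF eventually_l_pos]
        by eventually_elim (simp add: abs_mult less_imp_le t_pos)
      show "(\<lambda>n. t n * B) \<longlonglongrightarrow> 0" using tendsto_mult_right[OF t_tendsto, of B] by simp
    qed
    show "eventually (\<lambda>n. 0 < t n * l (u n)) sequentially"
      using eventually_at_scale[OF eventually_l_pos] by eventually_elim (simp add: t_pos)
  qed
  moreover have "exp (- (t n * (\<psi> v - \<psi> (u n)))) = exp (- (t n * \<psi> v)) / exp (- (t n * \<psi> (u n)))"
    for n v by (simp add: algebra_simps flip: exp_diff)
  then have "(exp (- (t n * (\<psi> (c * u n) - \<psi> (u n)))) - 1) / (t n * l (u n))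
      = increment_ratio c 1 n" for n
    by (simp add: increment_ratio_def weight_def diff_divide_distrib)
  ultimately show ?thesis by simp
qed

lemma increment_ratio_tendsto:
  assumes "0 < c" "0 < k"
  shows "increment_ratio c k \<longlonglongrightarrow> - ln c"
proof -
  have "(\<lambda>n. increment_ratio (c * k) 1 n - increment_ratio k 1 n) \<longlonglongrightarrow> - ln (c * k) - (- ln k)"
    using assms by (intro tendsto_diff increment_ratio_1_tendsto) auto
  moreover have "increment_ratio (c * k) 1 n - increment_ratio k 1 n = increment_ratio c k n" for n
    by (simp add: increment_ratio_def mult_ac flip: diff_divide_distrib)
  ultimately show ?thesis using assms by (simp add: ln_mult)
qed

lemma exponent_decrease_le:
  assumes \<delta>: "0 < \<delta>"
  obtains x0 where "eventually (\<lambda>n. \<forall>v\<ge>x0.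
    t n * (\<psi> (u n) - \<psi> v) \<le> \<delta> * (1 + \<bar>ln v - ln (u n)\<bar>)) sequentially"
proof -
  obtain K x0 where growth: "0 \<le> K" "0 < x0"
    "\<And>x y. x0 \<le> x \<Longrightarrow> x0 \<le> y \<Longrightarrow> \<bar>\<psi> y - \<psi> x\<bar> \<le> K * (1 + \<bar>ln y - ln x\<bar>)"
    by (rule logarithmic_growth) blast
  have "eventually (\<lambda>n. \<forall>v\<ge>x0. t n * (\<psi> (u n) - \<psi> v) \<le> \<delta> * (1 + \<bar>ln v - ln (u n)\<bar>)) sequentially"
    using eventually_t_mult_le[OF \<delta>, of K] eventually_at_scale[OF eventually_ge_at_top[of x0]]
  proof eventually_elim
    case (elim n)
    show ?case
    proof (intro allI impI)
      fix v assume "x0 \<le> v"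
      then have "\<psi> (u n) - \<psi> v \<le> K * (1 + \<bar>ln v - ln (u n)\<bar>)"
        using growth(3)[OF elim(2)] by fastforce
      then have "t n * (\<psi> (u n) - \<psi> v) \<le> t n * (K * (1 + \<bar>ln v - ln (u n)\<bar>))"
        using t_pos[of n] by (intro mult_left_mono) auto
      also have "\<dots> \<le> \<delta> * (1 + \<bar>ln v - ln (u n)\<bar>)"
        using mult_right_mono[OF elim(1), of "1 + \<bar>ln v - ln (u n)\<bar>"] by (simp add: mult.assoc)
      finally show "t n * (\<psi> (u n) - \<psi> v) \<le> \<delta> * (1 + \<bar>ln v - ln (u n)\<bar>)" .
    qed
  qed
  then show thesis by (rule that)
qed

lemma l_increase_le:
  assumes \<delta>: "0 < \<delta>"
  obtains x0 where "eventually (\<lambda>n. \<forall>v\<ge>x0.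
    l v \<le> l (u n) * exp (\<delta> * (1 + \<bar>ln v - ln (u n)\<bar>))) sequentially"
proof -
  obtain x1 where potter: "0 < x1"
    "\<And>x y. x1 \<le> x \<Longrightarrow> x1 \<le> y \<Longrightarrow> \<bar>ln (l y) - ln (l x)\<bar> \<le> \<delta> * (1 + \<bar>ln y - ln x\<bar>)"
    using potter_bound[OF \<delta>] by blast
  obtain x2 where l_pos: "\<And>x. x2 \<le> x \<Longrightarrow> 0 < l x"
    using eventually_l_pos by (auto simp: eventually_at_top_linorder)
  have "eventually (\<lambda>n. \<forall>v\<ge>max x1 x2. l v \<le> l (u n) * exp (\<delta> * (1 + \<bar>ln v - ln (u n)\<bar>)))
    sequentially"
    using eventually_at_scale[OF eventually_ge_at_top[of "max x1 x2"]]
  proof eventually_elim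
    case (elim n)
    show ?case
    proof (intro allI impI)
      fix v assume v: "max x1 x2 \<le> v"
      then have "ln (l v) \<le> ln (l (u n)) + \<delta> * (1 + \<bar>ln v - ln (u n)\<bar>)"
        using potter(2)[of "u n" v] elim by auto
      then have "exp (ln (l v)) \<le> exp (ln (l (u n)) + \<delta> * (1 + \<bar>ln v - ln (u n)\<bar>))" by simp
      then show "l v \<le> l (u n) * exp (\<delta> * (1 + \<bar>ln v - ln (u n)\<bar>))"
        using l_pos[of v] l_pos[of "u n"] v elim by (simp add: exp_add)
    qed
  qed
  then show thesis by (rule that)
qed

lemma abs_increment_ratio_le:
  assumes weight: "0 < weight n" and A: "0 \<le> A"
    and exponent: "t n * (\<psi> (u n) - \<psi> (u n * k)) \<le> E" "t n * (\<psi> (u n) - \<psi> (c * u n * k)) \<le> E"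
    and increment: "\<bar>\<psi> (c * u n * k) - \<psi> (u n * k)\<bar> \<le> A * l (u n * k)"
    and l_le: "l (u n * k) \<le> l (u n) * exp D"
  shows "\<bar>increment_ratio c k n\<bar> \<le> A * exp (D + E)"
proof -
  let ?e = "\<lambda>v. - (t n * \<psi> v)"
  have "\<bar>exp (?e (c * u n * k)) - exp (?e (u n * k))\<bar>
      \<le> \<bar>?e (c * u n * k) - ?e (u n * k)\<bar> * exp (?e (u n) + E)"
    using exponent by (intro abs_exp_diff_le) (auto simp: algebra_simps)
  also have "\<dots> = t n * exp (?e (u n)) * exp E * \<bar>\<psi> (c * u n * k) - \<psi> (u n * k)\<bar>"
    using t_pos[of n] unfolding exp_add[of "?e (u n)" E]
    by (simp add: abs_minus_commute abs_mult flip: right_diff_distrib)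
  also have "\<dots> \<le> t n * exp (?e (u n)) * exp E * (A * (l (u n) * exp D))"
    using order_trans[OF increment mult_left_mono[OF l_le A]] t_pos[of n]
    by (intro mult_left_mono) auto
  also have "\<dots> = weight n * (A * exp (D + E))"
    by (simp add: weight_def exp_add mult_ac)
  finally show ?thesis
    using weight by (simp add: increment_ratio_def abs_divide divide_le_eq mult.commute)
qed

lemma abs_increment_ratio_le_exp:
  assumes weight: "0 < weight n" and \<delta>: "0 < \<delta>" and c: "0 < c" and k: "0 < k"
    and exponent: "\<And>v. v \<in> {u n * k, c * u n * k} \<Longrightarrow>
      t n * (\<psi> (u n) - \<psi> v) \<le> \<delta> * (1 + \<bar>ln v - ln (u n)\<bar>)"
    and l_le: "l (u n * k) \<le> l (u n) * exp (\<delta> * (1 + \<bar>ln (u n * k) - ln (u n)\<bar>))"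
    and increment: "\<bar>\<psi> (c * u n * k) - \<psi> (u n * k)\<bar> \<le> (\<bar>ln c\<bar> + 1) * l (u n * k)"
  shows "\<bar>increment_ratio c k n\<bar>
    \<le> (\<bar>ln c\<bar> + 1) * exp (\<delta> * (2 + \<bar>ln c\<bar>)) * exp (2 * \<delta> * \<bar>ln k\<bar>)"
proof -
  have ln_diff: "ln (u n * k) - ln (u n) = ln k" "ln (c * u n * k) - ln (u n) = ln c + ln k"
    using u_pos[of n] k c by (auto simp: ln_mult)
  have "\<delta> * (1 + \<bar>ln k\<bar>) \<le> \<delta> * (1 + (\<bar>ln c\<bar> + \<bar>ln k\<bar>))"
      "\<delta> * (1 + \<bar>ln c + ln k\<bar>) \<le> \<delta> * (1 + (\<bar>ln c\<bar> + \<bar>ln k\<bar>))"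
    using \<delta> by (auto intro!: mult_left_mono)
  with exponent[of "u n * k"] exponent[of "c * u n * k"]
  have "t n * (\<psi> (u n) - \<psi> (u n * k)) \<le> \<delta> * (1 + (\<bar>ln c\<bar> + \<bar>ln k\<bar>))"
      "t n * (\<psi> (u n) - \<psi> (c * u n * k)) \<le> \<delta> * (1 + (\<bar>ln c\<bar> + \<bar>ln k\<bar>))"
    unfolding ln_diff by auto
  then have "\<bar>increment_ratio c k n\<bar>
      \<le> (\<bar>ln c\<bar> + 1) * exp (\<delta> * (1 + \<bar>ln k\<bar>) + \<delta> * (1 + (\<bar>ln c\<bar> + \<bar>ln k\<bar>)))"
    using weight increment l_le unfolding ln_diff by (intro abs_increment_ratio_le) auto
  then show ?thesis by (simp add: algebra_simps flip: exp_add)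
qed

lemma increment_ratio_le_above:
  assumes a: "0 < a" and c: "0 < c"
  obtains C z where "0 \<le> C" "0 < z" "eventually (\<lambda>n. \<forall>k>0. z \<le> u n * k \<longrightarrow>
    \<bar>increment_ratio c k n\<bar> \<le> C * exp (a * \<bar>ln k\<bar>)) sequentially"
proof -
  obtain \<delta> where \<delta>: "0 < \<delta>" "a = 2 * \<delta>" using a by (auto intro: that[of "a / 2"])
  obtain x1 where exponent: "eventually (\<lambda>n. \<forall>v\<ge>x1.
      t n * (\<psi> (u n) - \<psi> v) \<le> \<delta> * (1 + \<bar>ln v - ln (u n)\<bar>)) sequentially"
    by (rule exponent_decrease_le[OF \<delta>(1)])
  obtain x2 where l_le: "eventually (\<lambda>n. \<forall>v\<ge>x2.
      l v \<le> l (u n) * exp (\<delta> * (1 + \<bar>ln v - ln (u n)\<bar>))) sequentially"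
    by (rule l_increase_le[OF \<delta>(1)])
  obtain x3 where increment: "\<And>x. x3 \<le> x \<Longrightarrow> \<bar>\<psi> (c * x) - \<psi> x\<bar> \<le> (\<bar>ln c\<bar> + 1) * l x"
    using eventually_increment_le[OF c] by (auto simp: eventually_at_top_linorder)
  define y where "y = max 1 (max x1 (max x2 x3))"
  define z where "z = max y (y / c)"
  have z: "y \<le> z" "y \<le> c * z" "0 < z" using c by (auto simp: z_def y_def max_def field_simps)
  have "eventually (\<lambda>n. \<forall>k>0. z \<le> u n * k \<longrightarrow> \<bar>increment_ratio c k n\<bar>
      \<le> (\<bar>ln c\<bar> + 1) * exp (\<delta> * (2 + \<bar>ln c\<bar>)) * exp (2 * \<delta> * \<bar>ln k\<bar>)) sequentially"
    using exponent l_le eventually_weight_pos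
  proof eventually_elim
    case (elim n)
    show ?case
    proof (intro allI impI)
      fix k :: real assume k: "0 < k" "z \<le> u n * k"
      have "c * z \<le> c * (u n * k)" using k(2) c by (intro mult_left_mono) auto
      then have "y \<le> u n * k" "y \<le> c * u n * k" using z k(2) by auto
      then show "\<bar>increment_ratio c k n\<bar>
          \<le> (\<bar>ln c\<bar> + 1) * exp (\<delta> * (2 + \<bar>ln c\<bar>)) * exp (2 * \<delta> * \<bar>ln k\<bar>)"
        using elim increment[of "u n * k"] \<delta>(1) c k(1)
        by (intro abs_increment_ratio_le_exp) (auto simp: y_def mult.assoc)
    qed
  qed
  then show thesis using that[of "(\<bar>ln c\<bar> + 1) * exp (\<delta> * (2 + \<bar>ln c\<bar>))" z] z(3) \<delta>(2) by simp
qed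

lemma increment_ratio_le_below:
  assumes a: "0 < a" and c: "0 < c" and z: "0 < z"
  shows "eventually (\<lambda>n. \<forall>k>0. u n * k \<le> z \<longrightarrow> \<bar>increment_ratio c k n\<bar> \<le> z powr a * k powr (- a))
    sequentially"
  using eventually_weight_ge_powr[OF a]
proof eventually_elim
  case (elim n)
  show ?case
  proof (intro allI impI)
    fix k :: real assume k: "0 < k" "u n * k \<le> z"
    have "0 < u n powr (- a)" using u_pos[of n] by simp
    with elim have w: "0 < weight n" by linarith
    have exp_bounds: "0 < exp (- (t n * \<psi> s))" "exp (- (t n * \<psi> s)) \<le> 1" if "0 \<le> s" for s
      using nonneg[OF that] t_pos[of n] by auto
    have "\<bar>exp (- (t n * \<psi> (c * u n * k))) - exp (- (t n * \<psi> (u n * k)))\<bar> \<le> 1"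
    proof -
      have "0 \<le> c * u n * k" "0 \<le> u n * k" using u_pos[of n] k(1) c by auto
      from exp_bounds[OF this(1)] exp_bounds[OF this(2)] show ?thesis by linarith
    qed
    then have "\<bar>increment_ratio c k n\<bar> \<le> 1 / weight n"
      using w by (simp add: increment_ratio_def abs_divide divide_right_mono)
    also have "\<dots> \<le> u n powr a"
      using elim w u_pos[of n] by (simp add: powr_minus field_simps)
    also have "\<dots> \<le> (z / k) powr a"
      using k u_pos[of n] a by (intro powr_mono2) (auto simp: field_simps)
    also have "\<dots> = z powr a * k powr (- a)"
      using z k by (simp add: powr_divide powr_minus field_simps)
    finally show "\<bar>increment_ratio c k n\<bar> \<le> z powr a * k powr (- a)" .
  qed
qed

lemma increment_ratio_le:
  assumes a: "0 < a" and c: "0 < c"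
  obtains C where "eventually (\<lambda>n. \<forall>k>0.
    \<bar>increment_ratio c k n\<bar> \<le> C * (k powr a + k powr (- a))) sequentially"
proof -
  obtain C z where C: "0 \<le> C" "0 < z" "eventually (\<lambda>n. \<forall>k>0. z \<le> u n * k \<longrightarrow>
      \<bar>increment_ratio c k n\<bar> \<le> C * exp (a * \<bar>ln k\<bar>)) sequentially"
    by (rule increment_ratio_le_above[OF a c]) blast
  have "eventually (\<lambda>n. \<forall>k>0. \<bar>increment_ratio c k n\<bar> \<le> (C + z powr a) * (k powr a + k powr (- a)))
    sequentially"
    using C(3) increment_ratio_le_below[OF a c C(2)]
  proof eventually_elim
    case (elim n)
    show ?case
    proof (intro allI impI)
      fix k :: real assume k: "0 < k"
      have "\<bar>increment_ratio c k n\<bar> \<le> C * exp (a * \<bar>ln k\<bar>) + z powr a * k powr (- a)"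
        using elim k C(1) by (cases "z \<le> u n * k") (auto intro: add_increasing add_increasing2)
      also have "\<dots> \<le> C * (k powr a + k powr (- a)) + z powr a * (k powr a + k powr (- a))"
        using exp_mult_abs_ln_le[OF k] C(1) by (intro add_mono mult_left_mono) auto
      finally show "\<bar>increment_ratio c k n\<bar> \<le> (C + z powr a) * (k powr a + k powr (- a))"
        by (simp add: algebra_simps)
    qed
  qed
  then show thesis by (rule that)
qed

end

section \<open>The standard Gaussian vector\<close>

lemma integrable_std_normal_abs_powr:
  assumes a: "- 1 < a" "a \<le> 0"
  shows "integrable std_normal_distribution (\<lambda>s. \<bar>s\<bar> powr a)"
proof -
  have density_le: "std_normal_density s \<le> 1" for s
  proof -
    have "1 \<le> sqrt (2 * pi)" using pi_ge_two by (intro real_le_rsqrt) auto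
    then have "exp (- s\<^sup>2 / 2) \<le> sqrt (2 * pi)" by (rule order_trans[rotated]) simp
    then show ?thesis unfolding std_normal_density_def by (simp add: divide_simps)
  qed
  have "(\<lambda>s::real. s powr a) absolutely_integrable_on {0..1}"
    using a by (intro nonnegative_absolutely_integrable_1 integrable_on_powr_from_0) auto
  then have near_0: "integrable lborel (\<lambda>s. indicator {0..1} s *\<^sub>R s powr a)"
    unfolding set_integrable_def by (subst (asm) integrable_completion) auto
  have "integrable lborel (\<lambda>s. indicator {0..} s *\<^sub>R (std_normal_density s * \<bar>s\<bar> powr a))"
  proof (rule Bochner_Integration.integrable_bound)
    show "integrable lborel (\<lambda>s. indicator {0..1} s *\<^sub>R s powr a + std_normal_density s)"
      using near_0 by (intro Bochner_Integration.integrable_add integrable_normal_density) auto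
    have "std_normal_density s * s powr a \<le> indicator {0..1} s * s powr a + std_normal_density s"
      if "0 \<le> s" for s
    proof (cases "s \<le> 1")
      case True
      then show ?thesis
        using that mult_right_mono[OF density_le[of s], of "s powr a"]
        by (simp add: add_increasing2)
    next
      case False
      then have "s powr a \<le> 1 powr a" using a by (intro powr_mono2') auto
      then show ?thesis
        using False mult_left_mono[of "s powr a" 1 "std_normal_density s"] by simp
    qed
    then show "AE s in lborel. norm (indicator {0..} s *\<^sub>R (std_normal_density s * \<bar>s\<bar> powr a))
        \<le> norm (indicator {0..1} s *\<^sub>R s powr a + std_normal_density s)"
      by (intro AE_I2) (auto simp: indicator_def abs_mult)
  qed simp
  then have "integrable lborel (\<lambda>s. std_normal_density s *\<^sub>R \<bar>s\<bar> powr a)"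
    using has_bochner_integral_even_function[of "\<lambda>s. std_normal_density s * \<bar>s\<bar> powr a"]
    by (auto simp: has_bochner_integral_integrable std_normal_density_def has_bochner_integral_iff)
  then show ?thesis by (subst integrable_density) auto
qed

definition std_normal_vector :: "'a::euclidean_space measure" where
  "std_normal_vector =
    distr (Pi\<^sub>M Basis (\<lambda>_. std_normal_distribution)) borel (\<lambda>f. \<Sum>b\<in>Basis. f b *\<^sub>R b)"

lemma sets_std_normal_vector [simp, measurable_cong]: "sets std_normal_vector = sets borel"
  by (simp add: std_normal_vector_def)

lemma prob_space_std_normal_distribution: "prob_space std_normal_distribution"
  by (rule prob_space_normal_density) simp

lemma prob_space_std_normal_vector: "prob_space (std_normal_vector :: 'a::euclidean_space measure)"
  unfolding std_normal_vector_def
  by (intro prob_space.prob_space_distr prob_space_PiM prob_space_std_normal_distribution) simp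

lemma distr_std_normal_vector_component:
  assumes b: "b \<in> Basis"
  shows "distr (std_normal_vector :: 'a::euclidean_space measure) borel (\<lambda>g. g \<bullet> b) =
    std_normal_distribution"
proof -
  have "distr (std_normal_vector :: 'a measure) borel (\<lambda>g. g \<bullet> b) =
      distr (Pi\<^sub>M Basis (\<lambda>_::'a. std_normal_distribution)) borel (\<lambda>f. f b)"
    using b unfolding std_normal_vector_def
    by (subst distr_distr)
       (auto simp: comp_def inner_sum_left inner_Basis if_distrib cong: if_cong)
  also have "\<dots> =
      distr (Pi\<^sub>M Basis (\<lambda>_::'a. std_normal_distribution)) std_normal_distribution (\<lambda>f. f b)"
    by (intro distr_cong) auto
  also have "\<dots> = std_normal_distribution"
    using b by (intro distr_PiM_component prob_space_std_normal_distribution) auto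
  finally show ?thesis .
qed

lemma char_std_normal_vector:
  "(CLINT g|std_normal_vector. cis (z \<bullet> g)) = complex_of_real (exp (- (norm z)\<^sup>2 / 2))"
  for z :: "'a::euclidean_space"
proof -
  let ?P = "Pi\<^sub>M (Basis :: 'a set) (\<lambda>_. std_normal_distribution)"
  interpret N: prob_space std_normal_distribution by (rule prob_space_std_normal_distribution)
  interpret P: product_prob_space "\<lambda>_. std_normal_distribution" "Basis :: 'a set" by unfold_locales
  have "(CLINT g|std_normal_vector. cis (z \<bullet> g)) = (CLINT f|?P. cis (z \<bullet> (\<Sum>b\<in>Basis. f b *\<^sub>R b)))"
    unfolding std_normal_vector_def by (subst integral_distr) (auto simp: cis_conv_exp)
  also have "\<dots> = (CLINT f|?P. (\<Prod>b\<in>Basis. iexp ((z \<bullet> b) * f b)))"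
    by (intro Bochner_Integration.integral_cong refl)
       (simp add: cis_conv_exp inner_sum_right sum_distrib_left mult_ac flip: exp_sum)
  also have "\<dots> = (\<Prod>b\<in>Basis. CLINT s|std_normal_distribution. iexp ((z \<bullet> b) * s))"
    by (intro P.product_integral_prod N.integrable_iexp) auto
  also have "\<dots> = (\<Prod>b\<in>Basis. complex_of_real (exp (- (z \<bullet> b)\<^sup>2 / 2)))"
    using char_std_normal_distribution by (simp add: char_def fun_eq_iff)
  also have "\<dots> = complex_of_real (exp (\<Sum>b\<in>Basis. - (z \<bullet> b)\<^sup>2 / 2))"
    by (simp add: exp_sum)
  also have "(\<Sum>b\<in>Basis. - (z \<bullet> b)\<^sup>2 / 2) = - (norm z)\<^sup>2 / 2"
    by (subst euclidean_inner[of z z, folded power2_norm_eq_inner])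
       (simp add: sum_negf sum_divide_distrib power2_eq_square)
  finally show ?thesis .
qed

lemma integrable_std_normal_vector_component:
  fixes h :: "real \<Rightarrow> real"
  assumes "integrable std_normal_distribution h" "b \<in> Basis"
  shows "integrable (std_normal_vector :: 'a::euclidean_space measure) (\<lambda>g. h (g \<bullet> b))"
proof (rule integrable_distr[where T="\<lambda>g. g \<bullet> b" and f=h and M'=borel])
  show "integrable (distr (std_normal_vector :: 'a measure) borel (\<lambda>g. g \<bullet> b)) h"
    using assms by (simp add: distr_std_normal_vector_component)
qed simp

lemma AE_std_normal_vector_component_nonzero:
  assumes "b \<in> Basis"
  shows "AE g in (std_normal_vector :: 'a::euclidean_space measure). g \<bullet> b \<noteq> 0"
proof -
  have "AE s in std_normal_distribution. s \<noteq> 0"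
    by (subst AE_density) (auto intro: AE_mp[OF AE_lborel_singleton])
  then have "AE s in distr (std_normal_vector :: 'a measure) borel (\<lambda>g. g \<bullet> b). s \<noteq> 0"
    by (simp only: distr_std_normal_vector_component[OF assms])
  then show ?thesis by (subst (asm) AE_distr_iff) auto
qed

lemma integrable_norm_powr_std_normal_vector:
  assumes a: "- 1 < a" "a \<le> 1"
  shows "integrable (std_normal_vector :: 'a::euclidean_space measure) (\<lambda>g. norm g powr a)"
proof (cases "a \<le> 0")
  case True
  obtain b :: 'a where b: "b \<in> Basis" using nonempty_Basis by blast
  show ?thesis
  proof (rule Bochner_Integration.integrable_bound)
    show "integrable std_normal_vector (\<lambda>g::'a. \<bar>g \<bullet> b\<bar> powr a)"
      using a(1) True
      by (intro integrable_std_normal_vector_component integrable_std_normal_abs_powr b)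
    show "AE g::'a in std_normal_vector. norm (norm g powr a) \<le> norm (\<bar>g \<bullet> b\<bar> powr a)"
      using AE_std_normal_vector_component_nonzero[OF b]
      by eventually_elim (use True Basis_le_norm[OF b] in \<open>simp add: powr_mono2'\<close>)
  qed simp
next
  case False
  have integrable_abs: "integrable std_normal_distribution (\<lambda>s. \<bar>s\<bar>)"
    using integrable_std_normal_distribution_moment[of 1] by simp
  show ?thesis
  proof (rule Bochner_Integration.integrable_bound)
    show "integrable std_normal_vector (\<lambda>g::'a. 1 + (\<Sum>b\<in>Basis. \<bar>g \<bullet> b\<bar>))"
      using prob_space.finite_measure[OF prob_space_std_normal_vector]
      by (intro Bochner_Integration.integrable_add Bochner_Integration.integrable_sum
          finite_measure.integrable_const integrable_std_normal_vector_component integrable_abs)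
    have "norm g powr a \<le> 1 + (\<Sum>b\<in>Basis. \<bar>g \<bullet> b\<bar>)" for g :: 'a
    proof -
      have "norm g powr a \<le> max 1 (norm g) powr a" using False by (intro powr_mono2) auto
      also have "\<dots> \<le> max 1 (norm g) powr 1" using a(2) by (intro powr_mono) auto
      also have "\<dots> \<le> 1 + norm g" by simp
      also have "\<dots> \<le> 1 + (\<Sum>b\<in>Basis. \<bar>g \<bullet> b\<bar>)" by (intro add_left_mono norm_le_l1)
      finally show ?thesis .
    qed
    then show "AE g::'a in std_normal_vector. norm (norm g powr a) \<le> norm (1 + (\<Sum>b\<in>Basis. \<bar>g \<bullet> b\<bar>))"
      by (intro AE_I2) (auto intro: order_trans[OF _ abs_ge_self])
  qed simp
qed

lemma integral_cos_of_char:
  fixes \<mu> :: "'a::euclidean_space measure"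
  assumes \<mu>: "prob_space \<mu>" "sets \<mu> = sets borel"
    and char: "(CLINT x|\<mu>. cis (\<xi> \<bullet> x)) = complex_of_real r"
  shows "(LINT x|\<mu>. cos (\<xi> \<bullet> x)) = r"
proof -
  interpret prob_space \<mu> by fact
  note [measurable_cong] = \<mu>(2)
  have "integrable \<mu> (\<lambda>x. cis (\<xi> \<bullet> x))"
    by (intro integrable_const_bound[where B=1]) (auto simp: cis_conv_exp)
  from integral_Re[OF this] show ?thesis by (simp add: char)
qed

lemma gaussian_transform_eq_integral_char:
  fixes \<mu> :: "'a::euclidean_space measure"
  assumes \<mu>: "prob_space \<mu>" "sets \<mu> = sets borel"
    and char: "\<And>\<xi>. (CLINT x|\<mu>. cis (\<xi> \<bullet> x)) = complex_of_real (\<phi> \<xi>)"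
  shows "(LINT x|\<mu>. exp (- (s * norm x)\<^sup>2 / 2)) = (LINT g|std_normal_vector. \<phi> (s *\<^sub>R g))"
proof -
  note normal = prob_space_std_normal_vector sets_std_normal_vector
  interpret M: prob_space \<mu> by fact
  interpret G: prob_space "std_normal_vector :: 'a measure" by (rule normal)
  interpret MG: pair_prob_space \<mu> "std_normal_vector :: 'a measure" ..
  note [measurable_cong] = \<mu>(2)
  have "(LINT x|\<mu>. exp (- (s * norm x)\<^sup>2 / 2)) =
      (LINT x|\<mu>. LINT g|std_normal_vector. cos ((s *\<^sub>R x) \<bullet> g))"
    by (subst integral_cos_of_char[OF normal char_std_normal_vector]) (simp add: power_mult_distrib)
  also have "\<dots> = (LINT g|std_normal_vector. LINT x|\<mu>. cos ((s *\<^sub>R x) \<bullet> g))"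
    by (rule MG.Fubini_integral[symmetric])
       (auto intro!: MG.P.integrable_const_bound[where B=1])
  also have "\<dots> = (LINT g|std_normal_vector. \<phi> (s *\<^sub>R g))"
  proof -
    have "(s *\<^sub>R x) \<bullet> g = (s *\<^sub>R g) \<bullet> x" for x g :: 'a by (simp add: inner_commute)
    then show ?thesis by (simp only: integral_cos_of_char[OF \<mu> char])
  qed
  finally show ?thesis .
qed

context de_haan_scales
begin

lemma borel_measurable_radial: "(\<lambda>g::'a::euclidean_space. \<psi> (s * norm g)) \<in> borel_measurable borel"
  if "0 \<le> s"
  using measurable_compose[of "\<lambda>g::'a. s * norm g" borel borel, OF _ borel_measurable_abs] that
  by (simp add: abs_mult)

lemma integrable_exp_radial:
  assumes s: "0 \<le> s"
  shows "integrable std_normal_vector (\<lambda>g::'a::euclidean_space. exp (- (t n * \<psi> (s * norm g))))"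
proof -
  interpret prob_space "std_normal_vector :: 'a measure" by (rule prob_space_std_normal_vector)
  note [measurable] = borel_measurable_radial[OF s]
  show ?thesis
    using s t_pos[of n] by (intro integrable_const_bound[where B=1]) (auto simp: nonneg less_imp_le)
qed

lemma
  fixes c :: real
  assumes c: "0 < c"
  shows integrable_increment_ratio_norm:
      "integrable std_normal_vector (\<lambda>g::'a::euclidean_space. increment_ratio c (norm g) n)"
    and integral_increment_ratio_norm:
      "(LINT g::'a|std_normal_vector. increment_ratio c (norm g) n) =
        ((LINT g::'a|std_normal_vector. exp (- (t n * \<psi> (c * u n * norm g))))
          - (LINT g::'a|std_normal_vector. exp (- (t n * \<psi> (u n * norm g))))) / weight n"
proof -
  have "0 \<le> c * u n" "0 \<le> u n" using c u_pos[of n] by auto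
  note integrable_exp = integrable_exp_radial[OF this(1)] integrable_exp_radial[OF this(2)]
  show "integrable std_normal_vector (\<lambda>g::'a. increment_ratio c (norm g) n)"
    unfolding increment_ratio_def
    by (intro integrable_divide_zero Bochner_Integration.integrable_diff integrable_exp)
  show "(LINT g::'a|std_normal_vector. increment_ratio c (norm g) n) =
      ((LINT g::'a|std_normal_vector. exp (- (t n * \<psi> (c * u n * norm g))))
        - (LINT g::'a|std_normal_vector. exp (- (t n * \<psi> (u n * norm g))))) / weight n"
    unfolding increment_ratio_def integral_divide_zero
    by (subst Bochner_Integration.integral_diff[OF integrable_exp]) simp
qed

lemma gaussian_increment_tendsto:
  assumes c: "0 < c"
  shows "(\<lambda>n. ((LINT g::'a::euclidean_space|std_normal_vector. exp (- (t n * \<psi> (c * u n * norm g))))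
      - (LINT g::'a|std_normal_vector. exp (- (t n * \<psi> (u n * norm g))))) / weight n) \<longlonglongrightarrow> - ln c"
proof -
  let ?\<gamma> = "std_normal_vector :: 'a measure"
  have half: "0 < (1 / 2 :: real)" by simp
  obtain C where "eventually (\<lambda>n. \<forall>k>0.
      \<bar>increment_ratio c k n\<bar> \<le> C * (k powr (1/2) + k powr (- (1/2)))) sequentially"
    by (rule increment_ratio_le[OF half c])
  then obtain N where dominated: "\<And>n k. N \<le> n \<Longrightarrow> 0 < k \<Longrightarrow>
      \<bar>increment_ratio c k n\<bar> \<le> C * (k powr (1/2) + k powr (- (1/2)))"
    by (auto simp: eventually_sequentially)
  obtain b :: 'a where "b \<in> Basis" using nonempty_Basis by blast
  from AE_std_normal_vector_component_nonzero[OF this]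
  have nonzero: "AE g in ?\<gamma>. g \<noteq> 0" by eventually_elim auto
  have "(\<lambda>n. LINT g|?\<gamma>. increment_ratio c (norm g) (n + N)) \<longlonglongrightarrow> (LINT g|?\<gamma>. - ln c)"
  proof (rule integral_dominated_convergence)
    show "integrable ?\<gamma> (\<lambda>g. C * (norm g powr (1/2) + norm g powr (- (1/2))))"
      by (intro integrable_mult_right Bochner_Integration.integrable_add
          integrable_norm_powr_std_normal_vector) auto
    show "AE g in ?\<gamma>. (\<lambda>n. increment_ratio c (norm g) (n + N)) \<longlonglongrightarrow> - ln c"
      using nonzero
      by eventually_elim (auto intro!: LIMSEQ_ignore_initial_segment increment_ratio_tendsto c)
    show "AE g in ?\<gamma>. norm (increment_ratio c (norm g) (n + N))
        \<le> C * (norm g powr (1/2) + norm g powr (- (1/2)))" for n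
      using nonzero by eventually_elim (use dominated[of "n + N"] in simp)
  qed (use integrable_increment_ratio_norm[OF c] in \<open>auto dest: borel_measurable_integrable\<close>)
  then have "(\<lambda>n. LINT g|?\<gamma>. increment_ratio c (norm g) n) \<longlonglongrightarrow> (LINT g|?\<gamma>. - ln c)"
    by (rule LIMSEQ_offset)
  then show ?thesis
    unfolding integral_increment_ratio_norm[OF c]
    by (simp add: prob_space.prob_space[OF prob_space_std_normal_vector])
qed

end

section \<open>The method of moments\<close>

context real_distribution
begin

lemma integrable_power_of_bounded:
  assumes "AE x in M. \<bar>x\<bar> \<le> K"
  shows "integrable M (\<lambda>x. x ^ k)"
proof (rule integrable_const_bound[where B="K ^ k"])
  show "AE x in M. norm (x ^ k) \<le> K ^ k"
    using assms by eventually_elim (auto simp: power_abs intro: power_mono)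
qed simp

lemma char_approx_of_bounded:
  assumes bounded: "AE x in M. \<bar>x\<bar> \<le> K"
  shows "cmod (char M s - (\<Sum>k\<le>n. ((\<i> * s) ^ k / fact k) * expectation (\<lambda>x. x ^ k)))
    \<le> 2 * ((\<bar>s\<bar> * K) ^ n / fact n)"
proof -
  have "expectation (\<lambda>x. \<bar>x\<bar> ^ n) \<le> K ^ n"
  proof (rule integral_le_const)
    show "integrable M (\<lambda>x. \<bar>x\<bar> ^ n)"
      using integrable_abs[OF integrable_power_of_bounded[OF bounded, of n]]
      by (simp add: power_abs)
    show "AE x in M. \<bar>x\<bar> ^ n \<le> K ^ n"
      using bounded by eventually_elim (auto intro: power_mono)
  qed
  then have "2 * \<bar>s\<bar> ^ n / fact n * expectation (\<lambda>x. \<bar>x\<bar> ^ n) \<le> 2 * \<bar>s\<bar> ^ n / fact n * K ^ n"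
    by (intro mult_left_mono) auto
  with char_approx1[OF integrable_power_of_bounded[OF bounded], where n=n and t=s] show ?thesis
    by (simp add: power_mult_distrib)
qed

end

theorem weak_conv_of_moments:
  fixes M :: "nat \<Rightarrow> real measure" and M' :: "real measure"
  assumes M: "\<And>n. real_distribution (M n)" and M': "real_distribution M'"
    and bounded: "\<And>n. AE x in M n. \<bar>x\<bar> \<le> K" and bounded': "AE x in M'. \<bar>x\<bar> \<le> K"
    and moments: "\<And>k. (\<lambda>n. LINT x|M n. x ^ k) \<longlonglongrightarrow> (LINT x|M'. x ^ k)"
  shows "weak_conv_m M M'"
proof (rule levy_continuity[OF M M'], rule tendstoI)
  fix s e :: real assume e: "0 < e"
  define S where "S N j = (\<Sum>k\<le>j. ((\<i> * s) ^ k / fact k) * (LINT x|N. x ^ k))"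
    for N :: "real measure" and j
  have "(\<lambda>j. 2 * ((\<bar>s\<bar> * K) ^ j / fact j)) \<longlonglongrightarrow> 2 * 0"
    using summable_LIMSEQ_zero[OF summable_exp[of "\<bar>s\<bar> * K"]]
    by (intro tendsto_mult tendsto_const) (simp add: field_simps)
  then have "eventually (\<lambda>j. 2 * ((\<bar>s\<bar> * K) ^ j / fact j) < e / 3) sequentially"
    by (rule order_tendstoD) (use e in simp)
  then obtain j where j: "2 * ((\<bar>s\<bar> * K) ^ j / fact j) < e / 3"
    using eventually_happens'[OF sequentially_bot] by blast
  have "(\<lambda>n. S (M n) j) \<longlonglongrightarrow> S M' j"
    unfolding S_def by (intro tendsto_sum tendsto_mult tendsto_const tendsto_of_real moments)
  then have "eventually (\<lambda>n. dist (S (M n) j) (S M' j) < e / 3) sequentially"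
    by (rule tendstoD) (use e in simp)
  then show "eventually (\<lambda>n. dist (char (M n) s) (char M' s) < e) sequentially"
  proof eventually_elim
    case (elim n)
    have "dist (char (M n) s) (S (M n) j) < e / 3"
      unfolding dist_norm S_def
      by (rule le_less_trans[OF real_distribution.char_approx_of_bounded[OF M bounded] j])
    moreover have "dist (char M' s) (S M' j) < e / 3"
      unfolding dist_norm S_def
      by (rule le_less_trans[OF real_distribution.char_approx_of_bounded[OF M' bounded'] j])
    ultimately show ?case using elim
      dist_triangle[of "char (M n) s" "char M' s" "S (M n) j"]
      dist_triangle[of "S (M n) j" "char M' s" "S M' j"] dist_commute[of "char M' s" "S M' j"]
      by linarith
  qed
qed

section \<open>A Tauberian theorem\<close>

lemma nn_integral_exp_atLeast:
  fixes s :: real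
  assumes s: "0 < s"
  shows "(\<integral>\<^sup>+v\<in>{0..}. ennreal (exp (- (s * v))) \<partial>lborel) = ennreal (1 / s)"
proof -
  have "filterlim (\<lambda>v. - (s * v)) at_bot at_top"
    using filterlim_const_mult_at_top[OF s] by (simp add: filterlim_uminus_at_top)
  then have "((\<lambda>v. exp (- (s * v))) \<longlongrightarrow> 0) at_top" by (rule filterlim_compose[OF exp_at_bot])
  then have "((\<lambda>v. - (exp (- (s * v)) / s)) \<longlongrightarrow> 0) at_top"
    using tendsto_minus[OF tendsto_divide_zero] by fastforce
  then have "(\<integral>\<^sup>+v\<in>{0..}. ennreal (exp (- (s * v))) \<partial>lborel) =
      ennreal (0 - - (exp (- (s * 0)) / s))"
    using s by (intro nn_integral_FTC_atLeast) (auto intro!: derivative_eq_intros)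
  then show ?thesis by simp
qed

lemma has_bochner_integral_frullani_exp:
  fixes p q :: real
  assumes pq: "0 < p" "p \<le> q"
  shows "has_bochner_integral lborel
    (\<lambda>v. indicator {0<..} v * ((exp (- (p * v)) - exp (- (q * v))) / v)) (ln q - ln p)"
    (is "has_bochner_integral _ ?f _")
proof (rule has_bochner_integral_nn_integral)
  let ?e = "\<lambda>s v. ennreal (exp (- (s * v))) * indicator {p..q} s * indicator {0..} v"
  have inner: "(\<integral>\<^sup>+s\<in>{p..q}. ennreal (exp (- (s * v))) \<partial>lborel) =
      ennreal ((exp (- (p * v)) - exp (- (q * v))) / v)" if "0 < v" for v
  proof -
    have "(\<integral>\<^sup>+s\<in>{p..q}. ennreal (exp (- (s * v))) \<partial>lborel) =
        ennreal (- (exp (- (q * v)) / v) - - (exp (- (p * v)) / v))"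
      using pq that by (intro nn_integral_FTC_Icc) (auto intro!: derivative_eq_intros)
    then show ?thesis by (simp add: diff_divide_distrib)
  qed
  have "(\<integral>\<^sup>+v. ennreal (?f v) \<partial>lborel) = (\<integral>\<^sup>+v. (\<integral>\<^sup>+s. ?e s v \<partial>lborel) \<partial>lborel)"
  proof (rule nn_integral_cong_AE)
    show "AE v in lborel. ennreal (?f v) = (\<integral>\<^sup>+s. ?e s v \<partial>lborel)"
      using AE_lborel_singleton[of 0]
    proof eventually_elim
      case (elim v) then show ?case using inner[of v] by (cases "0 < v") auto
    qed
  qed
  also have "\<dots> = (\<integral>\<^sup>+s. (\<integral>\<^sup>+v. ?e s v \<partial>lborel) \<partial>lborel)"
    by (rule lborel_pair.Fubini') simp
  also have "\<dots> = (\<integral>\<^sup>+s\<in>{p..q}. ennreal (1 / s) \<partial>lborel)"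
    using nn_integral_exp_atLeast pq
    by (intro nn_integral_cong) (auto simp: indicator_def)
  also have "\<dots> = ennreal (ln q - ln p)"
    using pq by (intro nn_integral_FTC_Icc) (auto intro!: derivative_eq_intros simp: divide_inverse)
  finally show "(\<integral>\<^sup>+v. ennreal (?f v) \<partial>lborel) = ennreal (ln q - ln p)" .
  show "AE v in lborel. 0 \<le> ?f v"
    using pq by (intro AE_I2) (auto simp: indicator_def mult_right_mono)
qed (use pq in \<open>simp_all add: ln_mono\<close>)

definition log_measure :: "real measure" where
  "log_measure = density lborel (\<lambda>v. ennreal (indicator {0<..} v / v))"

lemma sets_log_measure [simp, measurable_cong]: "sets log_measure = sets borel"
  by (simp add: log_measure_def)

lemma AE_log_measure_pos: "AE v in log_measure. 0 < v"
  unfolding log_measure_def by (subst AE_density) (auto simp: indicator_def)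

lemma AE_log_measure_neq: "AE v in log_measure. v \<noteq> a"
  unfolding log_measure_def by (subst AE_density) (auto intro: AE_mp[OF AE_lborel_singleton])

lemma measure_log_measure_Ioc:
  assumes ab: "0 < a" "a \<le> b"
  shows "measure log_measure {a<..b} = ln b - ln a"
proof -
  have "emeasure log_measure {a<..b} =
      (\<integral>\<^sup>+v. ennreal (indicator {0<..} v / v) * indicator {a<..b} v \<partial>lborel)"
    by (simp add: log_measure_def emeasure_density)
  also have "\<dots> = (\<integral>\<^sup>+v\<in>{a..b}. ennreal (1 / v) \<partial>lborel)"
  proof (rule nn_integral_cong_AE)
    show "AE v in lborel. ennreal (indicator {0<..} v / v) * indicator {a<..b} v =
        ennreal (1 / v) * indicator {a..b} v"
      using AE_lborel_singleton[of a] by eventually_elim (use ab in \<open>auto simp: indicator_def\<close>)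
  qed
  also have "\<dots> = ennreal (ln b - ln a)"
    using ab by (intro nn_integral_FTC_Icc) (auto intro!: derivative_eq_intros simp: divide_inverse)
  finally show ?thesis using ab by (simp add: measure_def)
qed

definition laplace_weight :: "real \<Rightarrow> real" where
  "laplace_weight v = exp (- v) * (1 - exp (- v))"

lemma borel_measurable_laplace_weight [measurable]: "laplace_weight \<in> borel_measurable borel"
  unfolding laplace_weight_def[abs_def] by measurable

lemma laplace_weight_nonneg: "0 \<le> v \<Longrightarrow> 0 \<le> laplace_weight v"
  by (simp add: laplace_weight_def)

lemma laplace_weight_times_exp_power:
  "laplace_weight v * exp (- v) ^ k = exp (- (real (k + 1) * v)) - exp (- (real (k + 2) * v))"
  by (simp add: laplace_weight_def algebra_simps flip: exp_of_nat_mult exp_add)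

definition laplace_mass :: "'a measure \<Rightarrow> ('a \<Rightarrow> real) \<Rightarrow> real" where
  "laplace_mass M V = (LINT x|M. laplace_weight (V x))"

definition laplace_tilt :: "'a measure \<Rightarrow> ('a \<Rightarrow> real) \<Rightarrow> real measure" where
  "laplace_tilt M V =
    distr (density M (\<lambda>x. ennreal (laplace_weight (V x) / laplace_mass M V)))
      borel (\<lambda>x. exp (- V x))"

lemma sets_laplace_tilt [simp, measurable_cong]: "sets (laplace_tilt M V) = sets borel"
  by (simp add: laplace_tilt_def)

definition laplace_window :: "real \<Rightarrow> real \<Rightarrow> real \<Rightarrow> real" where
  "laplace_window a b y = indicator {exp (- b)..<exp (- a)} y / (y * (1 - y))"

lemma borel_measurable_laplace_window [measurable]: "laplace_window a b \<in> borel_measurable borel"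
  unfolding laplace_window_def[abs_def] by measurable

lemma laplace_weight_times_window:
  assumes "0 < a"
  shows "laplace_weight v * laplace_window a b (exp (- v)) = indicator {a<..b} v"
  using assms by (auto simp: laplace_weight_def laplace_window_def indicator_def)

lemma abs_laplace_window_le:
  assumes a: "0 < a"
  shows "\<bar>laplace_window a b y\<bar> \<le> 1 / (exp (- b) * (1 - exp (- a)))"
proof (cases "y \<in> {exp (- b)..<exp (- a)}")
  case True
  then have y: "exp (- b) \<le> y" "1 - exp (- a) \<le> 1 - y" "0 < 1 - exp (- a)" using a by auto
  then have "0 < y" by (auto intro: less_le_trans[OF exp_gt_zero])
  then have "exp (- b) * (1 - exp (- a)) \<le> y * (1 - y)" using y by (intro mult_mono) auto
  moreover have "0 < exp (- b) * (1 - exp (- a))" using y by simp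
  ultimately have "1 / (y * (1 - y)) \<le> 1 / (exp (- b) * (1 - exp (- a)))" "0 < y * (1 - y)"
    by (auto intro!: divide_left_mono)
  then show ?thesis using True by (simp add: laplace_window_def)
next
  case False
  then show ?thesis using a by (simp add: laplace_window_def)
qed

lemma isCont_laplace_window:
  assumes a: "0 < a" and y: "y \<noteq> exp (- a)" "y \<noteq> exp (- b)"
  shows "isCont (laplace_window a b) y"
proof (cases "y \<in> {exp (- b)<..<exp (- a)}")
  case True
  have "continuous_on {exp (- b)<..<exp (- a)} (\<lambda>y. 1 / (y * (1 - y)))"
  proof (intro continuous_intros ballI)
    fix y assume y: "y \<in> {exp (- b)<..<exp (- a)}"
    have "exp (- a) < 1" using a by simp
    then have "y < 1" using y by (auto intro: less_trans)
    moreover have "0 < y" using y by (auto intro: less_trans[OF exp_gt_zero])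
    ultimately show "y * (1 - y) \<noteq> 0" by simp
  qed
  then have "continuous_on {exp (- b)<..<exp (- a)} (laplace_window a b)"
    by (rule continuous_on_eq) (auto simp: laplace_window_def)
  then show ?thesis using True by (simp add: continuous_on_eq_continuous_at)
next
  case False
  have "continuous_on (- {exp (- b)..exp (- a)}) (laplace_window a b)"
    by (rule continuous_on_eq[of _ "\<lambda>_. 0"]) (auto simp: laplace_window_def)
  moreover have "open (- {exp (- b)..exp (- a)})" by (intro open_Compl closed_atLeastAtMost)
  ultimately show ?thesis using False y by (auto simp: continuous_on_eq_continuous_at)
qed

context
  fixes M :: "'a measure" and V :: "'a \<Rightarrow> real"
  assumes V [measurable]: "V \<in> borel_measurable M" and V_nonneg: "AE x in M. 0 \<le> V x"
    and mass_pos: "0 < laplace_mass M V"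
begin

lemma AE_laplace_density_nonneg: "AE x in M. 0 \<le> laplace_weight (V x) / laplace_mass M V"
  using V_nonneg by eventually_elim (use mass_pos in \<open>simp add: laplace_weight_nonneg\<close>)

lemma real_distribution_laplace_tilt: "real_distribution (laplace_tilt M V)"
proof (intro real_distribution.intro real_distribution_axioms.intro)
  let ?density = "\<lambda>x. laplace_weight (V x) / laplace_mass M V"
  have "integrable M (\<lambda>x. laplace_weight (V x))"
    using mass_pos not_integrable_integral_eq by (fastforce simp: laplace_mass_def)
  then have "(\<integral>\<^sup>+x. ennreal (?density x) \<partial>M) = ennreal (LINT x|M. ?density x)"
    by (intro nn_integral_eq_integral AE_laplace_density_nonneg integrable_divide_zero)
  also have "(LINT x|M. ?density x) = 1" using mass_pos by (simp add: laplace_mass_def)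
  finally have "emeasure (density M (\<lambda>x. ennreal (?density x))) (space M) = 1"
    by (subst emeasure_density) (auto cong: nn_integral_cong)
  then show "prob_space (laplace_tilt M V)"
    unfolding laplace_tilt_def by (intro prob_space.prob_space_distr prob_spaceI) auto
qed simp

lemma integral_laplace_tilt:
  fixes h :: "real \<Rightarrow> real"
  assumes [measurable]: "h \<in> borel_measurable borel"
  shows "(LINT y|laplace_tilt M V. h y) =
    (LINT x|M. laplace_weight (V x) * h (exp (- V x))) / laplace_mass M V"
proof -
  have "(LINT y|laplace_tilt M V. h y) =
      (LINT x|M. (laplace_weight (V x) / laplace_mass M V) *\<^sub>R h (exp (- V x)))"
    unfolding laplace_tilt_def
    by (subst integral_distr, simp, simp, subst integral_density)
       (auto intro: AE_laplace_density_nonneg)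
  then show ?thesis by simp
qed

lemma integral_laplace_window:
  assumes a: "0 < a"
  shows "(LINT y|laplace_tilt M V. laplace_window a b y) =
    measure M {x \<in> space M. a < V x \<and> V x \<le> b} / laplace_mass M V"
proof -
  have "(LINT x|M. laplace_weight (V x) * laplace_window a b (exp (- V x))) =
      (LINT x|M. indicator {x \<in> space M. a < V x \<and> V x \<le> b} x)"
    by (intro Bochner_Integration.integral_cong)
       (auto simp: laplace_weight_times_window[OF a] indicator_def)
  also have "\<dots> = measure M {x \<in> space M. a < V x \<and> V x \<le> b}"
    by (auto intro!: arg_cong[where f="measure M"])
  finally show ?thesis by (simp add: integral_laplace_tilt)
qed

lemma AE_laplace_tilt_abs_le_1: "AE y in laplace_tilt M V. \<bar>y\<bar> \<le> 1"
proof -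
  have "AE x in M. \<bar>exp (- V x)\<bar> \<le> 1" using V_nonneg by eventually_elim simp
  then show ?thesis
    unfolding laplace_tilt_def by (subst AE_distr_iff, simp, simp, subst AE_density) auto
qed

lemma AE_laplace_tilt_neq:
  assumes "AE x in M. V x \<noteq> a"
  shows "AE y in laplace_tilt M V. y \<noteq> exp (- a)"
  unfolding laplace_tilt_def using assms by (subst AE_distr_iff, simp, simp, subst AE_density) auto

end

lemma integral_laplace_weight_log_measure:
  "(LINT v|log_measure. laplace_weight v * exp (- v) ^ k) = ln (real (k + 2)) - ln (real (k + 1))"
proof -
  have "has_bochner_integral lborel
      (\<lambda>v. (indicator {0<..} v / v) *\<^sub>R (laplace_weight v * exp (- v) ^ k))
      (ln (real (k + 2)) - ln (real (k + 1)))"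
    using has_bochner_integral_frullani_exp[of "real (k + 1)" "real (k + 2)"]
    by (simp add: laplace_weight_times_exp_power)
  then have "has_bochner_integral log_measure (\<lambda>v. laplace_weight v * exp (- v) ^ k)
      (ln (real (k + 2)) - ln (real (k + 1)))"
    unfolding log_measure_def by (intro has_bochner_integral_density) (auto simp: indicator_def)
  then show ?thesis by (simp add: has_bochner_integral_iff)
qed

lemma laplace_mass_log_measure: "laplace_mass log_measure (\<lambda>v. v) = ln 2"
  using integral_laplace_weight_log_measure[of 0] by (simp add: laplace_mass_def)

lemma log_measure_tiltable:
  "(\<lambda>v. v) \<in> borel_measurable log_measure" "AE v in log_measure. 0 \<le> v"
  "0 < laplace_mass log_measure (\<lambda>v. v)"
proof -
  show "AE v in log_measure. 0 \<le> v" using AE_log_measure_pos by eventually_elim simp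
qed (simp_all add: laplace_mass_log_measure)

lemma integral_power_laplace_tilt_log_measure:
  "(LINT y|laplace_tilt log_measure (\<lambda>v. v). y ^ k) =
    (ln (real (k + 2)) - ln (real (k + 1))) / ln 2"
  using integral_laplace_weight_log_measure[of k]
  by (simp add: integral_laplace_tilt[OF log_measure_tiltable] laplace_mass_log_measure)

lemma integral_laplace_window_log_measure:
  assumes ab: "0 < a" "a \<le> b"
  shows "(LINT y|laplace_tilt log_measure (\<lambda>v. v). laplace_window a b y) = (ln b - ln a) / ln 2"
proof -
  have "{v \<in> space log_measure. a < v \<and> v \<le> b} = {a<..b}" by (auto simp: log_measure_def)
  then show ?thesis
    by (simp only: integral_laplace_window[OF log_measure_tiltable ab(1)]
        laplace_mass_log_measure measure_log_measure_Ioc[OF ab])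
qed

lemma emeasure_discontinuities_laplace_window:
  assumes a: "0 < a"
  shows "emeasure (laplace_tilt log_measure (\<lambda>v. v)) {y. \<not> isCont (laplace_window a b) y} = 0"
proof -
  let ?T = "laplace_tilt log_measure (\<lambda>v. v)"
  have "AE y in ?T. y \<noteq> exp (- a) \<and> y \<noteq> exp (- b)"
    by (intro AE_conjI AE_laplace_tilt_neq[OF log_measure_tiltable] AE_log_measure_neq)
  then have null: "{exp (- a), exp (- b)} \<in> null_sets ?T" by (subst AE_iff_null_sets) auto
  have "emeasure ?T {y. \<not> isCont (laplace_window a b) y} \<le> emeasure ?T {exp (- a), exp (- b)}"
  proof (rule emeasure_mono)
    show "{y. \<not> isCont (laplace_window a b) y} \<subseteq> {exp (- a), exp (- b)}"
      using isCont_laplace_window[OF a] by blast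
  qed simp
  then show ?thesis by (simp only: null_setsD1[OF null] le_zero_eq)
qed

locale laplace_log_increments =
  fixes P :: "nat \<Rightarrow> 'a measure" and V :: "nat \<Rightarrow> 'a \<Rightarrow> real" and w :: "nat \<Rightarrow> real"
  assumes prob_space: "prob_space (P n)"
    and V_measurable [measurable]: "V n \<in> borel_measurable (P n)"
    and V_nonneg: "0 \<le> V n x"
    and eventually_w_pos: "eventually (\<lambda>n. 0 < w n) sequentially"
    and laplace_increment: "0 < k \<Longrightarrow>
      (\<lambda>n. ((LINT x|P n. exp (- (real k * V n x))) - (LINT x|P n. exp (- V n x))) / w n)
        \<longlonglongrightarrow> - ln (real k)"
begin

definition moment :: "nat \<Rightarrow> nat \<Rightarrow> real" where
  "moment k n = (LINT x|P n. laplace_weight (V n x) * exp (- V n x) ^ k)"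

lemma moment_tendsto: "(\<lambda>n. moment k n / w n) \<longlonglongrightarrow> ln (real (k + 2)) - ln (real (k + 1))"
proof -
  define L where "L j n = (LINT x|P n. exp (- (real j * V n x)))" for j n
  have integrable: "integrable (P n) (\<lambda>x. exp (- (real j * V n x)))" for j n
  proof -
    interpret prob_space "P n" by (rule prob_space)
    show ?thesis using V_nonneg by (intro integrable_const_bound[where B=1]) auto
  qed
  have "moment k n = L (k + 1) n - L (k + 2) n" for n
    unfolding moment_def laplace_weight_times_exp_power L_def
    by (rule Bochner_Integration.integral_diff[OF integrable integrable])
  then have "moment k n / w n = (L (k + 1) n - L 1 n) / w n - (L (k + 2) n - L 1 n) / w n" for n
    by (simp add: diff_divide_distrib)
  moreover have "(\<lambda>n. (L (k + 1) n - L 1 n) / w n - (L (k + 2) n - L 1 n) / w n)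
      \<longlonglongrightarrow> - ln (real (k + 1)) - - ln (real (k + 2))"
    using laplace_increment[of "k + 1"] laplace_increment[of "k + 2"]
    by (intro tendsto_diff) (auto simp: L_def)
  ultimately show ?thesis by simp
qed

lemma laplace_mass_tendsto: "(\<lambda>n. laplace_mass (P n) (V n) / w n) \<longlonglongrightarrow> ln 2"
  using moment_tendsto[of 0] by (simp add: moment_def laplace_mass_def)

lemma eventually_laplace_mass_pos: "eventually (\<lambda>n. 0 < laplace_mass (P n) (V n)) sequentially"
proof -
  have "eventually (\<lambda>n. 0 < laplace_mass (P n) (V n) / w n) sequentially"
    using laplace_mass_tendsto by (rule order_tendstoD) simp
  then show ?thesis using eventually_w_pos by eventually_elim (simp add: zero_less_divide_iff)
qed

lemma moment_ratio_tendsto: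
  "(\<lambda>n. moment k n / laplace_mass (P n) (V n)) \<longlonglongrightarrow> (ln (real (k + 2)) - ln (real (k + 1))) / ln 2"
proof (rule Lim_transform_eventually)
  show "(\<lambda>n. (moment k n / w n) / (laplace_mass (P n) (V n) / w n))
      \<longlonglongrightarrow> (ln (real (k + 2)) - ln (real (k + 1))) / ln 2"
    by (intro tendsto_divide moment_tendsto laplace_mass_tendsto) simp
  show "eventually (\<lambda>n. (moment k n / w n) / (laplace_mass (P n) (V n) / w n) =
      moment k n / laplace_mass (P n) (V n)) sequentially"
    using eventually_w_pos by eventually_elim simp
qed

lemma laplace_tilt_weak_conv:
  assumes pos: "\<And>n. 0 < laplace_mass (P (n + N)) (V (n + N))"
  shows "weak_conv_m (\<lambda>n. laplace_tilt (P (n + N)) (V (n + N))) (laplace_tilt log_measure (\<lambda>v. v))"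
proof (rule weak_conv_of_moments[where K=1])
  note tiltable = V_measurable AE_I2[OF V_nonneg] pos
  fix k
  have "(LINT y|laplace_tilt (P (n + N)) (V (n + N)). y ^ k) =
      moment k (n + N) / laplace_mass (P (n + N)) (V (n + N))" for n
    by (simp add: integral_laplace_tilt[OF tiltable] moment_def)
  then show "(\<lambda>n. LINT y|laplace_tilt (P (n + N)) (V (n + N)). y ^ k)
      \<longlonglongrightarrow> (LINT y|laplace_tilt log_measure (\<lambda>v. v). y ^ k)"
    using LIMSEQ_ignore_initial_segment[OF moment_ratio_tendsto]
    by (simp add: integral_power_laplace_tilt_log_measure)
qed (intro real_distribution_laplace_tilt AE_laplace_tilt_abs_le_1 V_measurable AE_I2 V_nonneg pos
    log_measure_tiltable)+

lemma interval_mass_ratio_tendsto: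
  assumes ab: "0 < a" "a \<le> b"
  shows "(\<lambda>n. measure (P n) {x \<in> space (P n). a < V n x \<and> V n x \<le> b} / laplace_mass (P n) (V n))
    \<longlonglongrightarrow> (ln b - ln a) / ln 2" (is "?ratio \<longlonglongrightarrow> _")
proof -
  obtain N where "\<forall>n\<ge>N. 0 < laplace_mass (P n) (V n)"
    using eventually_laplace_mass_pos by (auto simp: eventually_sequentially)
  then have pos: "0 < laplace_mass (P (n + N)) (V (n + N))" for n by simp
  note tiltable = V_measurable AE_I2[OF V_nonneg] pos
  have "(\<lambda>n. LINT y|laplace_tilt (P (n + N)) (V (n + N)). laplace_window a b y)
      \<longlonglongrightarrow> (LINT y|laplace_tilt log_measure (\<lambda>v. v). laplace_window a b y)"
  proof (rule weak_conv_imp_bdd_ae_continuous_conv[OF _ _ laplace_tilt_weak_conv[OF pos]])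
    show "norm (laplace_window a b y) \<le> 1 / (exp (- b) * (1 - exp (- a)))" for y
      using abs_laplace_window_le[OF ab(1)] by simp
  qed (intro real_distribution_laplace_tilt tiltable log_measure_tiltable
      emeasure_discontinuities_laplace_window ab borel_measurable_laplace_window)+
  then have "(\<lambda>n. ?ratio (n + N)) \<longlonglongrightarrow> (ln b - ln a) / ln 2"
    by (simp add: integral_laplace_window[OF tiltable ab(1)]
        integral_laplace_window_log_measure[OF ab])
  then show ?thesis by (rule LIMSEQ_offset)
qed

theorem interval_mass_tendsto:
  assumes ab: "0 < a" "a \<le> b"
  shows "(\<lambda>n. measure (P n) {x \<in> space (P n). a < V n x \<and> V n x \<le> b} / w n) \<longlonglongrightarrow> ln b - ln a"
proof (rule Lim_transform_eventually)
  let ?m = "\<lambda>n. measure (P n) {x \<in> space (P n). a < V n x \<and> V n x \<le> b}"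
  let ?c = "\<lambda>n. laplace_mass (P n) (V n)"
  have "(\<lambda>n. ?m n / ?c n * (?c n / w n)) \<longlonglongrightarrow> (ln b - ln a) / ln 2 * ln 2"
    by (intro tendsto_mult interval_mass_ratio_tendsto[OF ab] laplace_mass_tendsto)
  then show "(\<lambda>n. ?m n / ?c n * (?c n / w n)) \<longlonglongrightarrow> ln b - ln a" by simp
  show "eventually (\<lambda>n. ?m n / ?c n * (?c n / w n) = ?m n / w n) sequentially"
    using eventually_laplace_mass_pos by eventually_elim simp
qed

end

section \<open>Radially nonincreasing densities\<close>

definition annulus :: "real \<Rightarrow> real \<Rightarrow> 'a::real_normed_vector set" where
  "annulus a b = {z. a < norm z \<and> norm z \<le> b}"

lemma annulus_eq_Diff: "annulus a b = cball 0 b - cball 0 a"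
  by (auto simp: annulus_def)

lemma sets_annulus [measurable]: "(annulus a b :: 'a::euclidean_space set) \<in> sets borel"
  by (simp add: annulus_eq_Diff)

lemma fmeasurable_annulus: "(annulus a b :: 'a::euclidean_space set) \<in> fmeasurable lborel"
proof (rule fmeasurableI2)
  show "(cball 0 b :: 'a set) \<in> fmeasurable lborel"
    using emeasure_lborel_cball_finite[of "0::'a" b] by (simp add: fmeasurable_def)
qed (auto simp: annulus_def)

lemma measure_annulus:
  assumes "0 \<le> a" "a \<le> b"
  shows "measure lborel (annulus a b :: 'a::euclidean_space set) =
    unit_ball_vol (real DIM('a)) * (b ^ DIM('a) - a ^ DIM('a))"
proof -
  have "measure lborel (cball 0 b - cball 0 a :: 'a set) =
      measure lborel (cball 0 b :: 'a set) - measure lborel (cball 0 a :: 'a set)"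
    using assms emeasure_lborel_cball_finite[of "0::'a" b] by (intro measure_Diff) auto
  then show ?thesis using assms by (simp add: annulus_eq_Diff content_cball algebra_simps)
qed

definition shell :: "real \<Rightarrow> real \<Rightarrow> 'a::real_normed_vector set" where
  "shell b r = annulus (min 1 b * r) (max 1 b * r)"

lemma sets_shell: "(shell b r :: 'a::euclidean_space set) \<in> sets borel"
  unfolding shell_def by (rule sets_annulus)

lemma zero_notin_shell: "0 \<le> b \<Longrightarrow> 0 \<le> r \<Longrightarrow> 0 \<notin> shell b r"
  by (simp add: shell_def annulus_def not_less)

lemma measure_shell:
  assumes "0 \<le> b" "0 \<le> r"
  shows "measure lborel (shell b r :: 'a::euclidean_space set) =
    unit_ball_vol (real DIM('a)) * \<bar>b ^ DIM('a) - 1\<bar> * r ^ DIM('a)"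
proof (cases "b \<le> 1")
  case True
  then have "b ^ DIM('a) \<le> 1" using assms by (simp add: power_le_one)
  then show ?thesis using True assms
    by (simp add: shell_def measure_annulus mult_left_le_one_le power_mult_distrib algebra_simps)
next
  case False
  then have "1 \<le> b ^ DIM('a)" by (simp add: one_le_power)
  then show ?thesis using False assms
    by (simp add: shell_def measure_annulus mult_le_cancel_right1 power_mult_distrib algebra_simps)
qed

lemma measure_shell_eq_unit_shell:
  assumes "0 \<le> b" "0 \<le> r"
  shows "measure lborel (shell b r :: 'a::euclidean_space set) =
    r ^ DIM('a) * measure lborel (shell b 1 :: 'a set)"
  using assms by (simp add: measure_shell)

lemma measure_unit_shell_pos:
  assumes "0 < b" "b \<noteq> 1"
  shows "0 < measure lborel (shell b 1 :: 'a::euclidean_space set)"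
proof -
  have "b ^ DIM('a) \<noteq> 1" using assms power_eq_iff_eq_base[of "DIM('a)" b 1] by simp
  then show ?thesis using assms by (simp add: measure_shell)
qed

lemma ln_div_power_minus_one_tendsto:
  assumes "0 < d"
  shows "((\<lambda>b::real. ln b / (b ^ d - 1)) \<longlongrightarrow> 1 / real d) (at 1)"
proof (rule Lim_transform_eventually)
  have "(ln has_real_derivative 1) (at (1::real))"
      "((\<lambda>b. b ^ d) has_real_derivative real d) (at (1::real))"
    by (auto intro!: derivative_eq_intros)
  then show "((\<lambda>b::real. ((ln b - ln 1) / (b - 1)) / ((b ^ d - 1 ^ d) / (b - 1)))
      \<longlongrightarrow> 1 / real d) (at 1)"
    using assms unfolding has_field_derivative_iff by (intro tendsto_divide) auto
qed (auto simp: eventually_at_filter)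

lemma abs_ln_div_measure_unit_shell_tendsto:
  "((\<lambda>b. \<bar>ln b\<bar> / measure lborel (shell b 1 :: 'a::euclidean_space set))
    \<longlongrightarrow> 1 / (real DIM('a) * unit_ball_vol (real DIM('a)))) (at 1)"
proof (rule Lim_transform_eventually)
  have "unit_ball_vol (real DIM('a)) \<noteq> 0" by (rule less_imp_neq[symmetric]) simp
  then have "((\<lambda>b. \<bar>ln b / (b ^ DIM('a) - 1)\<bar> / unit_ball_vol (real DIM('a)))
      \<longlongrightarrow> \<bar>1 / real DIM('a)\<bar> / unit_ball_vol (real DIM('a))) (at 1)"
    by (intro tendsto_divide[OF tendsto_rabs[OF ln_div_power_minus_one_tendsto] tendsto_const]) auto
  then show "((\<lambda>b. \<bar>ln b / (b ^ DIM('a) - 1)\<bar> / unit_ball_vol (real DIM('a)))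
      \<longlongrightarrow> 1 / (real DIM('a) * unit_ball_vol (real DIM('a)))) (at 1)"
    by simp
  have "eventually (\<lambda>b::real. 0 < b) (at 1)"
    by (rule order_tendstoD(1)[OF tendsto_ident_at]) simp
  then show "eventually (\<lambda>b. \<bar>ln b / (b ^ DIM('a) - 1)\<bar> / unit_ball_vol (real DIM('a)) =
      \<bar>ln b\<bar> / measure lborel (shell b 1 :: 'a set)) (at 1)"
    by eventually_elim (simp add: measure_shell abs_divide mult.commute)
qed

lemma tendsto_between_approximants:
  fixes q :: "'i \<Rightarrow> real" and g :: "real \<Rightarrow> 'i \<Rightarrow> real"
  assumes h: "(h \<longlongrightarrow> L) (at a)"
    and lower: "eventually (\<lambda>b. (g b \<longlongrightarrow> h b) F \<and> eventually (\<lambda>n. g b n \<le> q n) F) (at_right a)"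
    and upper: "eventually (\<lambda>b. (g b \<longlongrightarrow> h b) F \<and> eventually (\<lambda>n. q n \<le> g b n) F) (at_left a)"
  shows "(q \<longlongrightarrow> L) F"
proof (rule order_tendstoI)
  fix y assume "y < L"
  then have "eventually (\<lambda>b. y < h b) (at_right a)"
    using h by (auto simp: filterlim_at_split intro: order_tendstoD)
  then obtain b where b: "y < h b" "(g b \<longlongrightarrow> h b) F" "eventually (\<lambda>n. g b n \<le> q n) F"
    using eventually_happens'[OF _ eventually_conj[OF _ lower]] by fastforce
  from order_tendstoD(1)[OF b(2,1)] b(3) show "eventually (\<lambda>n. y < q n) F"
    by eventually_elim simp
next
  fix y assume "L < y"
  then have "eventually (\<lambda>b. h b < y) (at_left a)"
    using h by (auto simp: filterlim_at_split intro: order_tendstoD)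
  then obtain b where b: "h b < y" "(g b \<longlongrightarrow> h b) F" "eventually (\<lambda>n. q n \<le> g b n) F"
    using eventually_happens'[OF _ eventually_conj[OF _ upper]] by fastforce
  from order_tendstoD(2)[OF b(2,1)] b(3) show "eventually (\<lambda>n. q n < y) F"
    by eventually_elim simp
qed

lemma radially_nonincreasing_shell_bounds:
  fixes f :: "'a::euclidean_space \<Rightarrow> real"
  assumes dec: "radially_nonincreasing f" and f: "integrable lborel f" and x: "x \<noteq> 0"
  shows "1 < b \<Longrightarrow> (LINT z:shell b (norm x)|lborel. f z)
      \<le> f x * norm x ^ DIM('a) * measure lborel (shell b 1 :: 'a set)"
    and "0 < b \<Longrightarrow> b < 1 \<Longrightarrow> f x * norm x ^ DIM('a) * measure lborel (shell b 1 :: 'a set)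
      \<le> (LINT z:shell b (norm x)|lborel. f z)"
proof -
  let ?S = "shell b (norm x) :: 'a set"
  have S: "?S \<in> fmeasurable lborel" unfolding shell_def by (rule fmeasurable_annulus)
  have f: "set_integrable lborel ?S f"
    unfolding set_integrable_def using S
    by (intro integrable_mult_indicator f) (simp add: fmeasurable_def)
  have const: "set_integrable lborel ?S (\<lambda>_. f x)"
    using S by (simp add: fmeasurable_def set_integrable_def)
  have integral_const: "(LINT z:?S|lborel. f x) =
      f x * norm x ^ DIM('a) * measure lborel (shell b 1 :: 'a set)" if "0 < b"
    using S measure_shell_eq_unit_shell[of b "norm x", where ?'a='a] that
    by (simp add: fmeasurable_def set_integral_const less_top)
  show "(LINT z:?S|lborel. f z) \<le> f x * norm x ^ DIM('a) * measure lborel (shell b 1 :: 'a set)"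
    if "1 < b"
  proof -
    have "(LINT z:?S|lborel. f z) \<le> (LINT z:?S|lborel. f x)"
      by (rule set_integral_mono[OF f const])
         (use dec x that in \<open>auto simp: radially_nonincreasing_def shell_def annulus_def\<close>)
    then show ?thesis using integral_const that by simp
  qed
  show "f x * norm x ^ DIM('a) * measure lborel (shell b 1 :: 'a set) \<le> (LINT z:?S|lborel. f z)"
    if b: "0 < b" "b < 1"
    unfolding integral_const[OF b(1), symmetric]
  proof (rule set_integral_mono[OF const f])
    fix z assume "z \<in> ?S"
    then have z: "b * norm x < norm z" "norm z \<le> norm x"
      using b by (auto simp: shell_def annulus_def)
    moreover have "0 < b * norm x" using b x by simp
    ultimately have "0 < norm z" by linarith
    then show "f x \<le> f z" using dec z(2) by (simp add: radially_nonincreasing_def)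
  qed
qed

theorem radially_nonincreasing_density_tendsto:
  fixes f :: "nat \<Rightarrow> 'a::euclidean_space \<Rightarrow> real" and x :: "nat \<Rightarrow> 'a"
  assumes dec: "\<And>n. radially_nonincreasing (f n)" and f: "\<And>n. integrable lborel (f n)"
    and x: "\<And>n. x n \<noteq> 0" and w: "eventually (\<lambda>n. 0 < w n) sequentially"
    and mass: "\<And>b. 0 < b \<Longrightarrow>
      (\<lambda>n. (LINT z:shell b (norm (x n))|lborel. f n z) / w n) \<longlonglongrightarrow> \<bar>ln b\<bar>"
  shows "(\<lambda>n. f n (x n) * norm (x n) ^ DIM('a) / w n)
    \<longlonglongrightarrow> 1 / (real DIM('a) * unit_ball_vol (real DIM('a)))" (is "?q \<longlonglongrightarrow> _")
proof -
  let ?vol = "\<lambda>b. measure lborel (shell b 1 :: 'a set)"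
  define average where
    "average b n = (LINT z:shell b (norm (x n))|lborel. f n z) / w n / ?vol b" for b n
  have vol: "0 < ?vol b" if "0 < b" "b \<noteq> 1" for b using that by (rule measure_unit_shell_pos)
  have average_tendsto: "average b \<longlonglongrightarrow> \<bar>ln b\<bar> / ?vol b" if "0 < b" "b \<noteq> 1" for b
    unfolding average_def using vol[OF that] by (intro tendsto_divide mass[OF that(1)]) auto
  have lower: "eventually (\<lambda>n. average b n \<le> ?q n) sequentially" if "1 < b" for b
    using w
  proof eventually_elim
    case (elim n)
    then show ?case
      using radially_nonincreasing_shell_bounds(1)[OF dec f x that, of n n] vol[of b] that
      by (simp add: average_def field_simps)
  qed
  have upper: "eventually (\<lambda>n. ?q n \<le> average b n) sequentially" if "0 < b" "b < 1" for b
    using w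
  proof eventually_elim
    case (elim n)
    then show ?case
      using radially_nonincreasing_shell_bounds(2)[OF dec f x that, of n n] vol[of b] that
      by (simp add: average_def field_simps)
  qed
  show ?thesis
  proof (rule tendsto_between_approximants[OF abs_ln_div_measure_unit_shell_tendsto])
    show "eventually (\<lambda>b. average b \<longlonglongrightarrow> \<bar>ln b\<bar> / ?vol b \<and>
        eventually (\<lambda>n. average b n \<le> ?q n) sequentially) (at_right 1)"
      using eventually_at_right_less[of 1]
      by eventually_elim (intro conjI average_tendsto lower; simp)
    show "eventually (\<lambda>b. average b \<longlonglongrightarrow> \<bar>ln b\<bar> / ?vol b \<and>
        eventually (\<lambda>n. ?q n \<le> average b n) sequentially) (at_left 1)"
      using eventually_at_left_real[OF zero_less_one]
      by eventually_elim (intro conjI average_tendsto upper; simp)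
  qed
qed

lemma unit_ball_vol_times_dim:
  assumes "0 < d"
  shows "1 / (real d * unit_ball_vol (real d)) = Gamma (real d / 2) / (2 * pi powr (real d / 2))"
proof -
  have "Gamma (real d / 2 + 1) = real d / 2 * Gamma (real d / 2)"
    using assms by (intro Gamma_plus1) (auto elim!: nonpos_Ints_cases)
  moreover have "0 < Gamma (real d / 2)" using assms by (intro Gamma_real_pos) auto
  ultimately show ?thesis using assms by (simp add: unit_ball_vol_def field_simps)
qed

section \<open>Isotropic unimodal processes\<close>

context de_haan_scales
begin

lemma laplace_log_increments_radial:
  fixes P :: "nat \<Rightarrow> 'a::euclidean_space measure"
  assumes P: "\<And>n. prob_space (P n)" "\<And>n. sets (P n) = sets borel"
    and char: "\<And>n \<xi>. (CLINT x|P n. cis (\<xi> \<bullet> x)) = complex_of_real (exp (- (t n * \<psi> (norm \<xi>))))"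
  shows "laplace_log_increments P (\<lambda>n x. (u n * norm x)\<^sup>2 / 2) (\<lambda>n. weight n / 2)"
proof (rule laplace_log_increments.intro)
  define V where "V n x = (u n * norm x)\<^sup>2 / 2" for n and x :: 'a
  define G where "G c n = (LINT g::'a|std_normal_vector. exp (- (t n * \<psi> (c * u n * norm g))))"
    for c n
  have transform: "(LINT x|P n. exp (- (c\<^sup>2 * V n x))) = G c n" if "0 < c" for c n
  proof -
    have "(LINT x|P n. exp (- (c\<^sup>2 * V n x))) = (LINT x|P n. exp (- ((c * u n) * norm x)\<^sup>2 / 2))"
      by (simp add: V_def power_mult_distrib mult_ac)
    also have "\<dots> = G c n"
      unfolding gaussian_transform_eq_integral_char[OF P char] G_def
      using that u_pos[of n] by (simp add: abs_mult)
    finally show ?thesis .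
  qed
  fix k :: nat assume k: "0 < k"
  have "(\<lambda>n. 2 * ((G (sqrt k) n - G 1 n) / weight n)) \<longlonglongrightarrow> 2 * - ln (sqrt k)"
    unfolding G_def using gaussian_increment_tendsto[of "sqrt k", where 'a='a] k
    by (intro tendsto_mult_left) simp
  then show "(\<lambda>n. ((LINT x|P n. exp (- (real k * ((u n * norm x)\<^sup>2 / 2))))
        - (LINT x|P n. exp (- ((u n * norm x)\<^sup>2 / 2)))) / (weight n / 2)) \<longlonglongrightarrow> - ln (real k)"
    unfolding V_def[symmetric]
    using transform[of "sqrt k"] transform[of 1] k by (simp add: ln_sqrt mult.commute)
next
  show "(\<lambda>x. (u n * norm x)\<^sup>2 / 2) \<in> borel_measurable (P n)" for n
    unfolding measurable_cong_sets[OF P(2) refl] by simp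
  show "eventually (\<lambda>n. 0 < weight n / 2) sequentially" using eventually_weight_pos by simp
qed (simp_all add: P)

lemma shell_mass_tendsto:
  fixes P :: "nat \<Rightarrow> 'a::euclidean_space measure"
  assumes P: "\<And>n. prob_space (P n)" "\<And>n. sets (P n) = sets borel"
    and char: "\<And>n \<xi>. (CLINT x|P n. cis (\<xi> \<bullet> x)) = complex_of_real (exp (- (t n * \<psi> (norm \<xi>))))"
    and b: "0 < b"
  shows "(\<lambda>n. measure (P n) (shell b (1 / u n)) / weight n) \<longlonglongrightarrow> \<bar>ln b\<bar>"
proof -
  interpret laplace_log_increments P "\<lambda>n x. (u n * norm x)\<^sup>2 / 2" "\<lambda>n. weight n / 2"
    by (rule laplace_log_increments_radial[OF P char])
  define r s where "r = min 1 b" and "s = max 1 b"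
  have rs: "0 < r" "r \<le> s" "ln s - ln r = \<bar>ln b\<bar>"
    using b by (auto simp: r_def s_def max_def min_def)
  have "{x \<in> space (P n). r\<^sup>2 / 2 < (u n * norm x)\<^sup>2 / 2 \<and> (u n * norm x)\<^sup>2 / 2 \<le> s\<^sup>2 / 2} =
      shell b (1 / u n)" for n
  proof -
    have "(u n * norm x)\<^sup>2 / 2 \<le> c\<^sup>2 / 2 \<longleftrightarrow> norm x \<le> c * (1 / u n)" if "0 \<le> c" for c and x :: 'a
    proof -
      have "(u n * norm x)\<^sup>2 \<le> c\<^sup>2 \<longleftrightarrow> u n * norm x \<le> c"
        using that u_pos[of n] by (intro power_mono_iff) auto
      then show ?thesis using u_pos[of n] by (auto simp: field_simps)
    qed
    from this[of r] this[of s] show ?thesis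
      using rs sets_eq_imp_space_eq[OF P(2)]
      by (auto simp: shell_def annulus_def r_def s_def simp flip: not_le)
  qed
  then have "(\<lambda>n. measure (P n) (shell b (1 / u n)) / (weight n / 2))
      \<longlonglongrightarrow> ln (s\<^sup>2 / 2) - ln (r\<^sup>2 / 2)"
    using interval_mass_tendsto[of "r\<^sup>2 / 2" "s\<^sup>2 / 2"] rs by (simp add: power_mono)
  also have "ln (s\<^sup>2 / 2) - ln (r\<^sup>2 / 2) = 2 * \<bar>ln b\<bar>"
    using rs by (simp add: ln_div ln_realpow flip: rs(3))
  finally have "(\<lambda>n. measure (P n) (shell b (1 / u n)) / (weight n / 2) / 2) \<longlonglongrightarrow> 2 * \<bar>ln b\<bar> / 2"
    by (intro tendsto_divide tendsto_const) auto
  then show ?thesis by simp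
qed

end

lemma integrable_transition_density:
  assumes dens: "transition_density M X p" and M: "prob_space M" and t: "0 < t"
    and X: "X t \<in> borel_measurable M"
  shows "integrable lborel (p t)"
proof (rule integrableI_nonneg)
  interpret D: prob_space "distr M borel (X t)" using M X by (rule prob_space.prob_space_distr)
  have "(\<integral>\<^sup>+z. ennreal (p t z) \<partial>lborel) = (\<integral>\<^sup>+z\<in>UNIV - {0}. ennreal (p t z) \<partial>lborel)"
  proof (rule nn_integral_cong_AE)
    show "AE z in lborel. ennreal (p t z) = ennreal (p t z) * indicator (UNIV - {0}) z"
      using AE_lborel_singleton[of 0] by eventually_elim simp
  qed
  also have "\<dots> = emeasure (distr M borel (X t)) (UNIV - {0})"
    using dens t by (simp add: transition_density_def)
  also have "\<dots> < \<infinity>" by (simp add: D.emeasure_eq_measure)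
  finally show "(\<integral>\<^sup>+z. ennreal (p t z) \<partial>lborel) < \<infinity>" .
qed (use dens t in \<open>auto simp: transition_density_def\<close>)

lemma measure_transition_density:
  assumes dens: "transition_density M X p" and t: "0 < t" and A: "A \<in> sets borel" "0 \<notin> A"
  shows "measure (distr M borel (X t)) A = (LINT z:A|lborel. p t z)"
proof -
  have "emeasure (distr M borel (X t)) (A - {0}) = (\<integral>\<^sup>+z\<in>A - {0}. ennreal (p t z) \<partial>lborel)"
    using dens t A(1) unfolding transition_density_def by blast
  moreover have "A - {0} = A" using A(2) by simp
  ultimately have "emeasure (distr M borel (X t)) A = (\<integral>\<^sup>+z\<in>A. ennreal (p t z) \<partial>lborel)"
    by (simp only:)
  also have "\<dots> = (\<integral>\<^sup>+z. ennreal (indicator A z * p t z) \<partial>lborel)"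
    by (intro nn_integral_cong) (auto simp: indicator_def)
  finally show ?thesis
    using dens t A(1) unfolding set_lebesgue_integral_def measure_def
    by (subst integral_eq_nn_integral) (auto simp: transition_density_def)
qed

lemma one_minus_cos_le:
  fixes a :: real
  shows "1 - cos a \<le> a\<^sup>2 / 2"
proof -
  have "\<bar>sin (a / 2)\<bar>\<^sup>2 \<le> \<bar>a / 2\<bar>\<^sup>2" by (intro power_mono abs_sin_x_le_abs_x) simp
  then show ?thesis using cos_double_sin[of "a / 2"] by (simp add: power_divide)
qed

lemma levy_exponent_nonneg: "levy_density \<nu> \<Longrightarrow> 0 \<le> levy_exponent \<nu> \<xi>"
  unfolding levy_exponent_def levy_density_def by (intro Bochner_Integration.integral_nonneg) auto

lemma borel_measurable_levy_exponent:
  assumes "levy_density \<nu>"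
  shows "levy_exponent \<nu> \<in> borel_measurable borel"
proof -
  have [measurable]: "\<nu> \<in> borel_measurable borel" using assms by (simp add: levy_density_def)
  show ?thesis unfolding levy_exponent_def[abs_def] by measurable
qed

lemma levy_exponent_le:
  fixes \<nu> :: "'a::euclidean_space \<Rightarrow> real"
  assumes "levy_density \<nu>"
  shows "levy_exponent \<nu> \<xi> \<le> (2 + (norm \<xi>)\<^sup>2) * (LINT x|lborel. min 1 ((norm x)\<^sup>2) * \<nu> x)"
proof -
  have [measurable]: "\<nu> \<in> borel_measurable borel" and nonneg: "\<And>x. 0 \<le> \<nu> x"
    and finite: "(\<integral>\<^sup>+x. ennreal (min 1 ((norm x)\<^sup>2) * \<nu> x) \<partial>lborel) < \<infinity>"
    using assms by (auto simp: levy_density_def)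
  have integrable: "integrable lborel (\<lambda>x. min 1 ((norm x)\<^sup>2) * \<nu> x)"
    using finite nonneg by (intro integrableI_nonneg) auto
  have cos_le: "1 - cos (\<xi> \<bullet> x) \<le> (2 + (norm \<xi>)\<^sup>2) * min 1 ((norm x)\<^sup>2)" for x
  proof (cases "1 \<le> (norm x)\<^sup>2")
    case True
    have "1 - cos (\<xi> \<bullet> x) \<le> 2 + (norm \<xi>)\<^sup>2"
      using cos_ge_minus_one[of "\<xi> \<bullet> x"] zero_le_power2[of "norm \<xi>"] by linarith
    then show ?thesis using True by simp
  next
    case False
    have "1 - cos (\<xi> \<bullet> x) \<le> (\<xi> \<bullet> x)\<^sup>2 / 2" by (rule one_minus_cos_le)
    also have "\<dots> \<le> (\<xi> \<bullet> x)\<^sup>2" by simp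
    also have "\<dots> \<le> (norm \<xi>)\<^sup>2 * (norm x)\<^sup>2"
      using Cauchy_Schwarz_ineq[of \<xi> x] by (simp add: power2_norm_eq_inner)
    also have "\<dots> \<le> (2 + (norm \<xi>)\<^sup>2) * (norm x)\<^sup>2" by (intro mult_right_mono) auto
    finally show ?thesis using False by simp
  qed
  have "(1 - cos (\<xi> \<bullet> x)) * \<nu> x \<le> (2 + (norm \<xi>)\<^sup>2) * (min 1 ((norm x)\<^sup>2) * \<nu> x)" for x
    using mult_right_mono[OF cos_le nonneg[of x]] by (simp only: mult.assoc)
  then have "levy_exponent \<nu> \<xi> \<le> (LINT x|lborel. (2 + (norm \<xi>)\<^sup>2) * (min 1 ((norm x)\<^sup>2) * \<nu> x))"
    unfolding levy_exponent_def using integrable nonneg by (intro integral_mono') auto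
  then show ?thesis by (simp only: integral_mult_right_zero)
qed

lemma de_haan_exponent_levy_exponent:
  fixes \<nu> :: "'a::euclidean_space \<Rightarrow> real"
  assumes \<nu>: "levy_density \<nu>" and \<psi>: "\<And>\<xi>. levy_exponent \<nu> \<xi> = \<psi> (norm \<xi>)"
    and l: "slowly_varying_infty l" "\<exists>B a. \<forall>x\<ge>a. \<bar>l x\<bar> \<le> B" and de_haan: "de_haan_class l \<psi>"
  shows "de_haan_exponent \<psi> l"
proof
  obtain b :: 'a where "b \<in> Basis" using nonempty_Basis by blast
  then have \<psi>_eq: "\<psi> \<bar>s\<bar> = levy_exponent \<nu> (s *\<^sub>R b)" for s by (simp add: \<psi>)
  show "0 \<le> \<psi> s" if "0 \<le> s" for s
    using \<psi>_eq[of s] levy_exponent_nonneg[OF \<nu>] that by simp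
  show "(\<lambda>s. \<psi> \<bar>s\<bar>) \<in> borel_measurable borel"
    unfolding \<psi>_eq by (rule measurable_compose[OF _ borel_measurable_levy_exponent[OF \<nu>]]) simp
  show "\<exists>C. \<forall>s\<in>{0..r}. \<psi> s \<le> C" for r
  proof (intro exI ballI)
    let ?I = "LINT x|lborel. min 1 ((norm x)\<^sup>2) * \<nu> x"
    fix s assume s: "s \<in> {0..r}"
    have "\<psi> s \<le> (2 + s\<^sup>2) * ?I"
      using \<psi>_eq[of s] levy_exponent_le[OF \<nu>, of "s *\<^sub>R b"] s \<open>b \<in> Basis\<close> by simp
    also have "\<dots> \<le> (2 + r\<^sup>2) * ?I"
      using s \<nu>
      by (intro mult_right_mono add_left_mono power_mono Bochner_Integration.integral_nonneg)
         (auto simp: levy_density_def)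
    finally show "\<psi> s \<le> (2 + r\<^sup>2) * ?I" .
  qed
qed (fact l de_haan)+

theorem mainTheorem4:
  fixes M :: "'b measure" and X :: "real \<Rightarrow> 'b \<Rightarrow> 'a::euclidean_space"
    and \<nu> :: "'a \<Rightarrow> real" and p :: "real \<Rightarrow> 'a \<Rightarrow> real"
    and \<psi> :: "real \<Rightarrow> real" and l :: "real \<Rightarrow> real"
  assumes levy: "isotropic_unimodal_levy M X \<nu>"
    and dens: "transition_density M X p"
    and p_radial: "\<And>t. t > 0 \<Longrightarrow> radial (p t) \<and> radially_nonincreasing (p t)"
    and psi_radial: "\<And>\<xi>. levy_exponent \<nu> \<xi> = \<psi> (norm \<xi>)"
    and ell_sv: "slowly_varying_infty l"
    and ell_bdd: "\<exists>B a. \<forall>x\<ge>a. \<bar>l x\<bar> \<le> B"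
    and psi_Pi: "de_haan_class l \<psi>"
  shows "\<forall>(t :: nat \<Rightarrow> real) (x :: nat \<Rightarrow> 'a).
     (\<forall>n. 0 < t n \<and> x n \<noteq> 0) \<longrightarrow> t \<longlonglongrightarrow> 0 \<longrightarrow>
     filterlim (\<lambda>n. t n * \<psi> (1 / norm (x n))) at_top sequentially \<longrightarrow>
     (\<lambda>n. p (t n) (x n) /
        (t n * norm (x n) powr (- real DIM('a)) * l (1 / norm (x n))
          * exp (- (t n * \<psi> (1 / norm (x n))))))
     \<longlonglongrightarrow> Gamma (real DIM('a) / 2) / (2 * pi powr (real DIM('a) / 2))"
proof (intro allI impI)
  fix t :: "nat \<Rightarrow> real" and x :: "nat \<Rightarrow> 'a"
  assume tx: "\<forall>n. 0 < t n \<and> x n \<noteq> 0" and t: "t \<longlonglongrightarrow> 0"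
    and exponent: "filterlim (\<lambda>n. t n * \<psi> (1 / norm (x n))) at_top sequentially"
  have "de_haan_exponent \<psi> l"
    using levy psi_radial ell_sv ell_bdd psi_Pi
    by (intro de_haan_exponent_levy_exponent) (auto simp: isotropic_unimodal_levy_def)
  then interpret de_haan_scales \<psi> l t "\<lambda>n. 1 / norm (x n)"
    using tx t exponent by (simp add: de_haan_scales_def de_haan_scales_axioms_def)
  have M: "prob_space M" and X: "X (t n) \<in> borel_measurable M"
    and char: "(CLINT z|distr M borel (X (t n)). cis (\<xi> \<bullet> z)) =
      complex_of_real (exp (- (t n * \<psi> (norm \<xi>))))"
    for n \<xi> using levy tx by (auto simp: isotropic_unimodal_levy_def less_imp_le psi_radial)
  have "(\<lambda>n. (LINT z:shell b (norm (x n))|lborel. p (t n) z) / weight n) \<longlonglongrightarrow> \<bar>ln b\<bar>" if "0 < b" for b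
    using shell_mass_tendsto[OF prob_space.prob_space_distr[OF M X] sets_distr char that] tx that
    by (simp add: measure_transition_density[OF dens] zero_notin_shell sets_shell)
  then have "(\<lambda>n. p (t n) (x n) * norm (x n) ^ DIM('a) / weight n)
      \<longlonglongrightarrow> 1 / (real DIM('a) * unit_ball_vol (real DIM('a)))"
    using p_radial tx integrable_transition_density[OF dens M _ X] eventually_weight_pos
    by (intro radially_nonincreasing_density_tendsto) auto
  then show "(\<lambda>n. p (t n) (x n) / (t n * norm (x n) powr (- real DIM('a)) * l (1 / norm (x n))
        * exp (- (t n * \<psi> (1 / norm (x n))))))
      \<longlonglongrightarrow> Gamma (real DIM('a) / 2) / (2 * pi powr (real DIM('a) / 2))"
    using tx by (simp add: unit_ball_vol_times_dim weight_def powr_minus powr_realpow divide_simps)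
qed

end
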